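(* For integers $L\ge1$, $j\ge0$ and $y\ge0$ let $$a_{L,j}(y)=\int_{SU(2)}dg\,\chi_j(g)\,[1+y\chi_1(g)]^L,\qquad Y_L(y)=\frac{\sum_{j=0}^{L}a_{L,j}(y)^2\log_2(2j+1)}{\sum_{j=0}^{L}a_{L,j}(y)^2}.$$ For every $x\ge0$, $$\lim_{L\to\infty}Y_L(x/L)=\mathcal F(x),$$ locally uniformly in $x$, where $$A_j(x)=\int_{SU(2)}dg\,\chi_j(g)e^{x\chi_1(g)}=e^x\big[I_j(2x)-I_{j+1}(2x)\big],$$ $$p_j(x)=\frac{A_j(x)^2}{\sum_{k\ge0}A_k(x)^2}=\frac{[I_j(2x)-I_{j+1}(2x)]^2}{I_0(4x)-I_1(4x)},\qquad \mathcal F(x)=\sum_{j=0}^{\infty}p_j(x)\log_2(2j+1),$$ with $j,k$ ranging over nonnegative integers. The two asymptotic regimes are $$\mathcal F(x)=x^2\log_23+O(x^3)\quad(x\downarrow0),\qquad \mathcal F(x)=\tfrac12\log_2(2x)+\frac{1-\gamma/2}{\ln2}+o(1)\quad(x\to\infty),$$ where $\gamma$ is Euler's constant.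
   Context: $dg$ is normalized Haar measure on $SU(2)$; $\chi_j$ is the (real-valued) character of the spin-$j$ irreducible representation of $SU(2)$, of dimension $2j+1$; $I_j$ is the modified Bessel function of the first kind of order $j$. *)

theory Defs
  imports
    "HOL-Analysis.Analysis"
    "HOL-Probability.Probability_Measure"
    "HOL-Computational_Algebra.Polynomial"
    "HOL-Library.Landau_Symbols"
begin

definition SU2 :: "(complex ^ 2 ^ 2) set" where
  "SU2 = {g. g ** (\<chi> i j. cnj (g $ j $ i)) = mat 1 \<and> det g = 1}"

text \<open>Left invariance is enough: the group is compact, hence unimodular, and the measure below
  is unique.\<close>
definition normalized_haar_SU2 :: "(complex ^ 2 ^ 2) measure \<Rightarrow> bool" where
  "normalized_haar_SU2 M \<longleftrightarrow>
     prob_space M \<and> sets M = sets (restrict_space borel SU2) \<and>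
     (\<forall>g\<in>SU2. distr M M (\<lambda>h. g ** h) = M)"

text \<open>For integer \<open>j\<close>, the spin-\<open>j\<close> irreducible representation acts on the homogeneous
  polynomials of degree \<open>2 j\<close> in two variables by \<open>(\<pi>(g) f)(z, w) = f((z, w) g)\<close>.
  The basis vector \<open>z^k w^(2j-k)\<close>, with \<open>0 \<le> k \<le> 2 j\<close>, is sent to
  \<open>(g11 z + g21 w)^k (g12 z + g22 w)^(2j-k)\<close>. Setting \<open>w = 1\<close> turns the coefficient of
  \<open>z^l w^(2j-l)\<close> into that of degree \<open>l\<close> of a univariate polynomial; this is the
  \<open>(l, k)\<close> entry of the representing matrix.\<close>
definition spin_matrix :: "nat \<Rightarrow> complex ^ 2 ^ 2 \<Rightarrow> nat \<Rightarrow> nat \<Rightarrow> complex" where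
  "spin_matrix j g l k =
     coeff ([:g $ 2 $ 1, g $ 1 $ 1:] ^ k * [:g $ 2 $ 2, g $ 1 $ 2:] ^ (2 * j - k)) l"

text \<open>The trace is real on \<open>SU2\<close> (lemma \<open>spin_trace_real\<close> below), so \<open>Re\<close> only
  changes the type.\<close>
definition spin_char :: "nat \<Rightarrow> complex ^ 2 ^ 2 \<Rightarrow> real" where
  "spin_char j g = Re (\<Sum>k\<le>2 * j. spin_matrix j g k k)"

lemma spin_matrix_diag:
  assumes "k \<le> 2 * j"
  shows "spin_matrix j g k k =
    (\<Sum>m\<le>2 * j. of_nat (k choose m) * of_nat ((2 * j - k) choose m) * (g $ 1 $ 1) ^ (k - m)
       * (g $ 2 $ 1 * g $ 1 $ 2) ^ m * (g $ 2 $ 2) ^ (2 * j - k - m))"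
    (is "_ = (\<Sum>m\<le>_. ?t m)")
proof -
  have "spin_matrix j g k k =
    (\<Sum>i\<le>k. coeff ([:g $ 2 $ 1, g $ 1 $ 1:] ^ k) i * coeff ([:g $ 2 $ 2, g $ 1 $ 2:] ^ (2 * j - k)) (k - i))"
    by (simp add: spin_matrix_def coeff_mult)
  also have "\<dots> =
    (\<Sum>m\<le>k. coeff ([:g $ 2 $ 1, g $ 1 $ 1:] ^ k) (k - m) * coeff ([:g $ 2 $ 2, g $ 1 $ 2:] ^ (2 * j - k)) m)"
    by (rule sum.reindex_bij_witness[of _ "\<lambda>m. k - m" "\<lambda>m. k - m"]) auto
  also have "\<dots> = (\<Sum>m\<le>k. ?t m)"
  proof (rule sum.cong[OF refl])
    fix m assume m: "m \<in> {..k}"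
    hence "(k choose (k - m)) = (k choose m)"
      by (metis atMost_iff binomial_symmetric)
    moreover have "coeff ([:g $ 2 $ 2, g $ 1 $ 2:] ^ (2 * j - k)) m = 0" if "\<not> m \<le> 2 * j - k"
    proof (rule coeff_eq_0)
      have "degree ([:g $ 2 $ 2, g $ 1 $ 2:] ^ (2 * j - k)) \<le> degree [:g $ 2 $ 2, g $ 1 $ 2:] * (2 * j - k)"
        by (rule degree_power_le)
      also have "\<dots> \<le> 2 * j - k"
        by simp
      finally show "degree ([:g $ 2 $ 2, g $ 1 $ 2:] ^ (2 * j - k)) < m"
        using that by linarith
    qed
    ultimately show "coeff ([:g $ 2 $ 1, g $ 1 $ 1:] ^ k) (k - m) *
        coeff ([:g $ 2 $ 2, g $ 1 $ 2:] ^ (2 * j - k)) m = ?t m"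
      using m by (cases "m \<le> 2 * j - k")
        (auto simp: coeff_linear_poly_power power_mult_distrib binomial_eq_0)
  qed
  also have "\<dots> = (\<Sum>m\<le>2 * j. ?t m)"
    using assms by (intro sum.mono_neutral_left) (auto simp: binomial_eq_0)
  finally show ?thesis .
qed

lemma SU2_entries:
  assumes "g \<in> SU2"
  shows "g $ 2 $ 2 = cnj (g $ 1 $ 1)" and "g $ 2 $ 1 = - cnj (g $ 1 $ 2)"
proof -
  let ?a = "g $ 1 $ 1" and ?b = "g $ 1 $ 2" and ?c = "g $ 2 $ 1" and ?d = "g $ 2 $ 2"
  have u: "g ** (\<chi> i j. cnj (g $ j $ i)) = mat 1" and d: "?a * ?d - ?b * ?c = 1"
    using assms by (auto simp: SU2_def det_2)
  from u have "(g ** (\<chi> i j. cnj (g $ j $ i))) $ i $ j = (mat 1 :: complex ^ 2 ^ 2) $ i $ j" for i j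
    by simp
  from this[of 1 1] this[of 2 1]
  have e: "?a * cnj ?a + ?b * cnj ?b = 1" "?c * cnj ?a + ?d * cnj ?b = 0"
    by (simp_all add: matrix_matrix_mult_def mat_def sum_2)
  have "?d = ?d * (?a * cnj ?a + ?b * cnj ?b) - ?b * (?c * cnj ?a + ?d * cnj ?b)"
    by (simp add: e)
  also have "\<dots> = (?a * ?d - ?b * ?c) * cnj ?a"
    by (simp add: algebra_simps)
  finally show "?d = cnj ?a"
    using d by simp
  have "?c = ?c * (?a * cnj ?a + ?b * cnj ?b) - ?a * (?c * cnj ?a + ?d * cnj ?b)"
    by (simp add: e)
  also have "\<dots> = - ((?a * ?d - ?b * ?c) * cnj ?b)"
    by (simp add: algebra_simps)
  finally show "?c = - cnj ?b"
    using d by simp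
qed

lemma spin_trace_real:
  assumes "g \<in> SU2"
  shows "(\<Sum>k\<le>2 * j. spin_matrix j g k k) \<in> \<real>"
proof -
  have "cnj (spin_matrix j g k k) = spin_matrix j g (2 * j - k) (2 * j - k)" if "k \<le> 2 * j" for k
    using that
    by (auto simp: spin_matrix_diag SU2_entries[OF assms] mult_ac intro!: sum.cong)
  hence "cnj (\<Sum>k\<le>2 * j. spin_matrix j g k k) = (\<Sum>k\<le>2 * j. spin_matrix j g (2 * j - k) (2 * j - k))"
    by simp
  also have "\<dots> = (\<Sum>k\<le>2 * j. spin_matrix j g k k)"
    by (rule sum.reindex_bij_witness[of _ "\<lambda>k. 2 * j - k" "\<lambda>k. 2 * j - k"]) auto
  finally show ?thesis
    by (simp add: Reals_cnj_iff)
qed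

definition bessel_I :: "nat \<Rightarrow> real \<Rightarrow> real" where
  "bessel_I j x = (\<Sum>m. (x / 2) ^ (2 * m + j) / (fact m * fact (m + j)))"

definition a_coeff :: "(complex ^ 2 ^ 2) measure \<Rightarrow> nat \<Rightarrow> nat \<Rightarrow> real \<Rightarrow> real" where
  "a_coeff M L j y = (LINT g|M. spin_char j g * (1 + y * spin_char 1 g) ^ L)"

definition Y_fun :: "(complex ^ 2 ^ 2) measure \<Rightarrow> nat \<Rightarrow> real \<Rightarrow> real" where
  "Y_fun M L y =
     (\<Sum>j\<le>L. (a_coeff M L j y)\<^sup>2 * log 2 (2 * real j + 1)) / (\<Sum>j\<le>L. (a_coeff M L j y)\<^sup>2)"

definition A_coeff :: "(complex ^ 2 ^ 2) measure \<Rightarrow> nat \<Rightarrow> real \<Rightarrow> real" where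
  "A_coeff M j x = (LINT g|M. spin_char j g * exp (x * spin_char 1 g))"

definition p_weight :: "(complex ^ 2 ^ 2) measure \<Rightarrow> nat \<Rightarrow> real \<Rightarrow> real" where
  "p_weight M j x = (A_coeff M j x)\<^sup>2 / (\<Sum>k. (A_coeff M k x)\<^sup>2)"

definition F_fun :: "(complex ^ 2 ^ 2) measure \<Rightarrow> real \<Rightarrow> real" where
  "F_fun M x = (\<Sum>j. p_weight M j x * log 2 (2 * real j + 1))"

end

(* Left translation by diagonal matrices and by one rotation shows that the integral of chi_j vanishes for
   j >= 1. Together with chi_1 chi_j = chi_(j+1) + chi_j + chi_(j-1) this determines every
   integral of chi_j chi_1^n, and the same recursion holds for the averages of
   (1 + 2 cos t)^n (cos jt - cos (j+1)t) over a period; this is the Weyl integration formula for the functions that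
   occur, and it yields the Bessel functions. Since multiplication by chi_1 is a symmetric operator,
   the denominators are sum_j a_(L,j)^2 = a_(2L,0) and sum_k A_k(x)^2 = A_0(2x).

   Convergence is locally uniform because A_j(x)^2 - a_(L,j)(x/L)^2 is a power series in x with nonnegative
   coefficients: it is largest at the right endpoint, where Tannery's theorem applies.

   For large x, sqrt x p_j(x) at j = v sqrt x converges, up to normalization, to the Maxwell density
   v^2 exp (-v^2/2), with domination from one integration by parts in t. Hence
   ln 2 F(x) - (ln x)/2 tends to the mean of ln (2v) for that density,
   which is Digamma(3/2)/2 + (3/2) ln 2 = 1 - gamma/2 + (ln 2)/2. *)
theory Submission
  imports
    Defs
    "HOL-Probability.Characteristic_Functions"
    "HOL-Probability.Sinc_Integral"
    "HOL-Real_Asymp.Real_Asymp"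
begin

subsection \<open>Characters of symmetric powers\<close>

text \<open>The only hold on the measure is left invariance, so recursions in the power of chi_1
  carry values from the Haar measure to the circle, and nonnegativity of their integer solution
  \<open>adj_mult\<close> supplies every monotonicity used for the limit in L. The obstacle for
  large x is that the sums are infinite while the weight ln is unbounded at both ends. The factor x
  exp (- 2 x) makes I_j(2x) - I_(j+1)(2x) of order one at j = v sqrt x. The scaled difference is
  bounded by 32 and, after the integration by parts, by 64 / w with w = (2 j + 1) / sqrt x. Its
  square is therefore of order (1 + w)^(-2), which is integrable against weights of size (1 + w) /
  sqrt w. This class contains both 1 and ln, so one limit theorem covers numerator and denominator,
  and the normalizing constants cancel in the quotient.\<close>

definition mcoeff :: "complex ^ 2 ^ 2 \<Rightarrow> nat \<Rightarrow> nat \<Rightarrow> nat \<Rightarrow> complex" where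
  "mcoeff g a b l = coeff ([:g $ 2 $ 1, g $ 1 $ 1:] ^ a * [:g $ 2 $ 2, g $ 1 $ 2:] ^ b) l"

text \<open>A diagonal matrix entry on binary forms of degree k + l. Counting the powers of the two
  variables separately keeps natural-number subtraction out of the recursion.\<close>

abbreviation sym_coeff :: "complex ^ 2 ^ 2 \<Rightarrow> nat \<Rightarrow> nat \<Rightarrow> complex" where
  "sym_coeff g k l \<equiv> mcoeff g k l k"

definition sym_trace :: "complex ^ 2 ^ 2 \<Rightarrow> nat \<Rightarrow> complex" where
  "sym_trace g n = (\<Sum>k\<le>n. sym_coeff g k (n - k))"

lemma sym_coeff_Suc_0: "sym_coeff g (Suc k) 0 = g $ 1 $ 1 * sym_coeff g k 0"
proof -
  have "degree ([:g $ 2 $ 1, g $ 1 $ 1:] ^ k) \<le> degree [:g $ 2 $ 1, g $ 1 $ 1:] * k"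
    by (rule degree_power_le)
  also have "\<dots> \<le> k" by simp
  finally have "coeff ([:g $ 2 $ 1, g $ 1 $ 1:] ^ k) (Suc k) = 0"
    by (intro coeff_eq_0) simp
  thus ?thesis by (simp add: mcoeff_def)
qed

lemma sym_coeff_0_Suc: "sym_coeff g 0 (Suc l) = g $ 2 $ 2 * sym_coeff g 0 l"
  by (simp add: mcoeff_def coeff_mult_0)

text \<open>Equivalently, \<open>sym_coeff\<close> has the generating function \<open>1 / ((1 - a u) (1 - d v) - b c u v)\<close>.\<close>
lemma sym_coeff_Suc_Suc:
  "sym_coeff g (Suc k) (Suc l) =
     g $ 1 $ 1 * sym_coeff g k (Suc l) + g $ 2 $ 2 * sym_coeff g (Suc k) l - det g * sym_coeff g k l"
proof -
  define P where "P = [:g $ 2 $ 1, g $ 1 $ 1:]"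
  define Q where "Q = [:g $ 2 $ 2, g $ 1 $ 2:]"
  define R where "R = P ^ k * Q ^ l"
  have P: "coeff (P * X) (Suc n) = g $ 2 $ 1 * coeff X (Suc n) + g $ 1 $ 1 * coeff X n" for X n
    by (simp add: P_def)
  have Q: "coeff (Q * X) (Suc n) = g $ 2 $ 2 * coeff X (Suc n) + g $ 1 $ 2 * coeff X n" for X n
    by (simp add: Q_def)
  \<comment> \<open>Everything reduces to coefficients of R at k and k + 1, except that coefficient
    k of Q * R stays unexpanded, since k may be 0.\<close>
  have "sym_coeff g (Suc k) (Suc l) = coeff (P * (Q * R)) (Suc k)"
    unfolding mcoeff_def P_def[symmetric] Q_def[symmetric] R_def by (simp add: algebra_simps)
  moreover have "sym_coeff g k (Suc l) = coeff (Q * R) k"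
    unfolding mcoeff_def P_def[symmetric] Q_def[symmetric] R_def by (simp add: algebra_simps)
  moreover have "sym_coeff g (Suc k) l = coeff (P * R) (Suc k)"
    unfolding mcoeff_def P_def[symmetric] Q_def[symmetric] R_def by (simp add: algebra_simps)
  moreover have "sym_coeff g k l = coeff R k"
    unfolding mcoeff_def P_def[symmetric] Q_def[symmetric] R_def by (simp add: algebra_simps)
  ultimately show ?thesis
    by (simp add: P Q det_2 algebra_simps)
qed

text \<open>Chebyshev recursion, obtained without diagonalizing g: \<open>sym_coeff_Suc_Suc\<close>
  is summed over an antidiagonal, and the two extreme entries supply exactly the end terms that the
  shifted sums miss.\<close>

lemma sym_trace_Suc_Suc:
  "sym_trace g (Suc (Suc n)) = (g $ 1 $ 1 + g $ 2 $ 2) * sym_trace g (Suc n) - det g * sym_trace g n"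
proof -
  let ?s = "sym_coeff g" and ?a = "g $ 1 $ 1" and ?d = "g $ 2 $ 2"
  have "sym_trace g (Suc (Suc n)) =
      ?s 0 (Suc (Suc n)) + (\<Sum>k\<le>n. ?s (Suc k) (Suc (n - k))) + ?s (Suc (Suc n)) 0"
    unfolding sym_trace_def sum.atMost_Suc_shift[of _ "Suc n"] sum.atMost_Suc[of _ n]
    by (simp add: Suc_diff_le add.assoc)
  also have "(\<Sum>k\<le>n. ?s (Suc k) (Suc (n - k))) =
      ?a * (\<Sum>k\<le>n. ?s k (Suc n - k)) + ?d * (\<Sum>k\<le>n. ?s (Suc k) (n - k)) - det g * sym_trace g n"
    by (simp add: sym_coeff_Suc_Suc sym_trace_def sum.distrib sum_subtractf sum_distrib_left Suc_diff_le)
  also have "(\<Sum>k\<le>n. ?s k (Suc n - k)) = sym_trace g (Suc n) - ?s (Suc n) 0"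
    by (simp add: sym_trace_def)
  also have "(\<Sum>k\<le>n. ?s (Suc k) (n - k)) = sym_trace g (Suc n) - ?s 0 (Suc n)"
    by (simp add: sym_trace_def sum.atMost_Suc_shift del: sum.atMost_Suc)
  finally show ?thesis
    by (simp add: sym_coeff_Suc_0[of g "Suc n"] sym_coeff_0_Suc[of g "Suc n"] algebra_simps)
qed

lemma sym_trace_0: "sym_trace g 0 = 1" and sym_trace_1: "sym_trace g (Suc 0) = g $ 1 $ 1 + g $ 2 $ 2"
  by (simp_all add: sym_trace_def mcoeff_def)

lemma of_real_spin_char:
  assumes "g \<in> SU2"
  shows "of_real (spin_char j g) = sym_trace g (2 * j)"
proof -
  have "(\<Sum>k\<le>2 * j. spin_matrix j g k k) = sym_trace g (2 * j)"
    by (simp add: sym_trace_def mcoeff_def spin_matrix_def)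
  thus ?thesis
    using spin_trace_real[OF assms, of j] by (simp add: spin_char_def)
qed

text \<open>Clebsch-Gordan rule for the adjoint character t^2 - 1, with t the trace. The odd degrees
  (half-integer spins) are eliminated between three instances of the recursion.\<close>

lemma sym_trace_2_mult:
  assumes "det g = 1"
  shows "sym_trace g 2 * sym_trace g (Suc (Suc n)) =
    sym_trace g (Suc (Suc (Suc (Suc n)))) + sym_trace g (Suc (Suc n)) + sym_trace g n"
proof -
  define t where "t = g $ 1 $ 1 + g $ 2 $ 2"
  have rec: "sym_trace g (Suc (Suc m)) = t * sym_trace g (Suc m) - sym_trace g m" for m
    by (simp add: sym_trace_Suc_Suc assms t_def)
  have "sym_trace g 2 = t * t - 1"
    using rec[of 0] by (simp add: sym_trace_0 sym_trace_1 t_def numeral_2_eq_2)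
  thus ?thesis
    using rec[of n] rec[of "Suc n"] rec[of "Suc (Suc n)"] by algebra
qed

lemma det_SU2: "g \<in> SU2 \<Longrightarrow> det g = 1"
  by (simp add: SU2_def)

lemma spin_char_0: "g \<in> SU2 \<Longrightarrow> spin_char 0 g = 1"
  using of_real_spin_char[of g 0] by (simp add: sym_trace_0)

lemma spin_char_Suc_Suc:
  assumes "g \<in> SU2"
  shows "spin_char 1 g * spin_char (Suc j) g = spin_char (Suc (Suc j)) g + spin_char (Suc j) g + spin_char j g"
proof -
  have "complex_of_real (spin_char 1 g * spin_char (Suc j) g) =
      of_real (spin_char (Suc (Suc j)) g + spin_char (Suc j) g + spin_char j g)"
    using sym_trace_2_mult[OF det_SU2[OF assms], of "2 * j"]
    unfolding of_real_mult of_real_add of_real_spin_char[OF assms] by simp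
  thus ?thesis using of_real_eq_iff by blast
qed

section \<open>Bounds on matrix entries and on the adjoint character\<close>

lemma SU2_norm_entries:
  assumes "g \<in> SU2"
  shows "(cmod (g $ 1 $ 1))\<^sup>2 + (cmod (g $ 1 $ 2))\<^sup>2 = 1"
proof -
  have "g $ 1 $ 1 * cnj (g $ 1 $ 1) + g $ 1 $ 2 * cnj (g $ 1 $ 2) = 1"
    using det_SU2[OF assms] by (simp add: det_2 SU2_entries[OF assms])
  hence "complex_of_real ((cmod (g $ 1 $ 1))\<^sup>2 + (cmod (g $ 1 $ 2))\<^sup>2) = of_real 1"
    by (simp only: complex_norm_square of_real_add of_real_1)
  thus ?thesis using of_real_eq_iff by blast
qed

lemma SU2_cmod_entry_le:
  assumes "g \<in> SU2"
  shows "cmod (g $ i $ j) \<le> 1"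
proof -
  have "(cmod (g $ 1 $ 1))\<^sup>2 \<le> 1\<^sup>2" "(cmod (g $ 1 $ 2))\<^sup>2 \<le> 1\<^sup>2"
    using SU2_norm_entries[OF assms] zero_le_power2[of "cmod (g $ 1 $ 1)"] zero_le_power2[of "cmod (g $ 1 $ 2)"]
    unfolding one_power2 by linarith+
  hence "cmod (g $ 1 $ 1) \<le> 1" "cmod (g $ 1 $ 2) \<le> 1"
    using power2_le_imp_le zero_le_one by blast+
  thus ?thesis
    using exhaust_2[of i] exhaust_2[of j] by (auto simp: SU2_entries[OF assms])
qed

text \<open>The triangle inequality in t^2 - 1 with |t| at most 2 gives 4 + 1; the sharp constant is
  3, but only dominated convergence relies on this.\<close>

lemma spin_char_1_bound:
  assumes "g \<in> SU2"
  shows "\<bar>spin_char 1 g\<bar> \<le> 5"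
proof -
  define t where "t = g $ 1 $ 1 + g $ 2 $ 2"
  have "complex_of_real (spin_char 1 g) = sym_trace g (Suc (Suc 0))"
    using of_real_spin_char[OF assms, of 1] by (simp add: numeral_2_eq_2)
  also have "\<dots> = t\<^sup>2 - 1"
    by (simp add: sym_trace_Suc_Suc sym_trace_0 sym_trace_1 det_SU2[OF assms] t_def power2_eq_square)
  finally have "\<bar>spin_char 1 g\<bar> = cmod (t\<^sup>2 - 1)"
    by (metis norm_of_real)
  also have "\<dots> \<le> (cmod t)\<^sup>2 + 1"
    using norm_triangle_ineq4[of "t\<^sup>2" 1] by (simp add: norm_power)
  also have "cmod t \<le> 2"
    unfolding t_def
    by (rule norm_triangle_le) (use SU2_cmod_entry_le[OF assms, of 1 1] SU2_cmod_entry_le[OF assms, of 2 2] in linarith)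
  hence "(cmod t)\<^sup>2 \<le> 2\<^sup>2"
    by (intro power_mono) auto
  finally show ?thesis by simp
qed

subsection \<open>Haar integrals of characters\<close>

text \<open>Each nonzero summand is a monomial of degree l in the first row of g and a + b - l in
  the second. Continuity, boundedness and the behavior under diagonal translation are read off from
  this.\<close>

lemma mcoeff_eq:
  "mcoeff g a b l = (\<Sum>i\<le>l. (of_nat (a choose i) * (g $ 1 $ 1) ^ i * (g $ 2 $ 1) ^ (a - i)) *
     (of_nat (b choose (l - i)) * (g $ 1 $ 2) ^ (l - i) * (g $ 2 $ 2) ^ (b - (l - i))))"
proof -
  have "coeff ([:c, d:] ^ n) i = of_nat (n choose i) * d ^ i * c ^ (n - i)" for c d :: complex and n i
  proof (cases "i \<le> n")
    case False
    hence "degree ([:c, d:] ^ n) < i"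
      using degree_power_le[of "[:c, d:]" n] by (auto split: if_splits)
    thus ?thesis using False by (simp add: coeff_eq_0 binomial_eq_0)
  qed (rule coeff_linear_poly_power)
  thus ?thesis by (simp only: mcoeff_def coeff_mult)
qed

lemma continuous_on_mcoeff: "continuous_on A (\<lambda>g. mcoeff g a b l)"
  unfolding mcoeff_eq by (intro continuous_intros)

lemma mcoeff_bounded: "\<exists>B. \<forall>g\<in>SU2. cmod (mcoeff g a b l) \<le> B"
proof (intro exI ballI)
  fix g assume g: "g \<in> SU2"
  have p: "cmod (g $ i $ j) ^ n \<le> 1" for i j n
    using SU2_cmod_entry_le[OF g, of i j] by (intro power_le_one) auto
  have "cmod (mcoeff g a b l) \<le> (\<Sum>i\<le>l. (real (a choose i) * 1 * 1) * (real (b choose (l - i)) * 1 * 1))"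
    unfolding mcoeff_eq
    by (intro sum_norm_le, unfold norm_mult norm_power norm_of_nat)
      (intro mult_mono mult_nonneg_nonneg p; simp)
  thus "cmod (mcoeff g a b l) \<le> (\<Sum>i\<le>l. (real (a choose i) * 1 * 1) * (real (b choose (l - i)) * 1 * 1))" .
qed

text \<open>Homogeneity in each row. The truncated subtractions are genuine only where both
  binomials are nonzero, hence the case distinction.\<close>

lemma mcoeff_diagonal_mult:
  assumes "h $ 1 $ 2 = 0" "h $ 2 $ 1 = 0"
  shows "mcoeff (h ** g) a b l = (h $ 1 $ 1) ^ l * (h $ 2 $ 2) ^ (a + b - l) * mcoeff g a b l"
proof -
  let ?u = "h $ 1 $ 1" and ?v = "h $ 2 $ 2"
  have h: "(h ** g) $ 1 $ i = ?u * g $ 1 $ i" "(h ** g) $ 2 $ i = ?v * g $ 2 $ i" for i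
    using assms by (simp_all add: matrix_matrix_mult_def sum_2)
  have *: "(of_nat (a choose i) * (?u * g $ 1 $ 1) ^ i * (?v * g $ 2 $ 1) ^ (a - i)) *
        (of_nat (b choose (l - i)) * (?u * g $ 1 $ 2) ^ (l - i) * (?v * g $ 2 $ 2) ^ (b - (l - i))) =
      (?u ^ l * ?v ^ (a + b - l)) * ((of_nat (a choose i) * (g $ 1 $ 1) ^ i * (g $ 2 $ 1) ^ (a - i)) *
        (of_nat (b choose (l - i)) * (g $ 1 $ 2) ^ (l - i) * (g $ 2 $ 2) ^ (b - (l - i))))"
    if "i \<le> l" for i
  proof (cases "i \<le> a \<and> l - i \<le> b")
    case True
    hence "a + b - l = (a - i) + (b - (l - i))" and "l = i + (l - i)" using that by auto
    hence "?u ^ l * ?v ^ (a + b - l) = (?u ^ i * ?u ^ (l - i)) * (?v ^ (a - i) * ?v ^ (b - (l - i)))"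
      by (metis power_add)
    thus ?thesis by (simp add: power_mult_distrib mult_ac)
  next
    case False
    thus ?thesis by (auto simp: binomial_eq_0)
  qed
  show ?thesis
    unfolding mcoeff_eq h sum_distrib_left by (intro sum.cong refl *) simp
qed

lemma mcoeff_top:
  "mcoeff g j j (2 * j) = (g $ 1 $ 1 * g $ 1 $ 2) ^ j"
proof -
  have "mcoeff g j j (2 * j) = (\<Sum>i\<in>{j}. (of_nat (j choose i) * (g $ 1 $ 1) ^ i * (g $ 2 $ 1) ^ (j - i)) *
     (of_nat (j choose (2 * j - i)) * (g $ 1 $ 2) ^ (2 * j - i) * (g $ 2 $ 2) ^ (j - (2 * j - i))))"
    unfolding mcoeff_eq
  proof (rule sum.mono_neutral_right)
    show "\<forall>i\<in>{..2 * j} - {j}. (of_nat (j choose i) * (g $ 1 $ 1) ^ i * (g $ 2 $ 1) ^ (j - i)) *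
      (of_nat (j choose (2 * j - i)) * (g $ 1 $ 2) ^ (2 * j - i) * (g $ 2 $ 2) ^ (j - (2 * j - i))) = 0"
    proof
      fix i assume "i \<in> {..2 * j} - {j}"
      hence "i > j \<or> 2 * j - i > j" by auto
      thus "(of_nat (j choose i) * (g $ 1 $ 1) ^ i * (g $ 2 $ 1) ^ (j - i)) *
        (of_nat (j choose (2 * j - i)) * (g $ 1 $ 2) ^ (2 * j - i) * (g $ 2 $ 2) ^ (j - (2 * j - i))) = 0"
        by (auto simp: binomial_eq_0)
    qed
  qed auto
  thus ?thesis by (simp add: power_mult_distrib)
qed

text \<open>Evaluation of the product at 1. It pairs with \<open>mcoeff_top\<close>: a rotation by
  pi / 4 turns the values of both linear factors at 1, up to a scalar, into their leading
  coefficients.\<close>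

lemma sum_mcoeff:
  "(\<Sum>l\<le>2 * j. mcoeff g j j l) = ((g $ 1 $ 1 + g $ 2 $ 1) * (g $ 1 $ 2 + g $ 2 $ 2)) ^ j"
proof -
  let ?p = "[:g $ 2 $ 1, g $ 1 $ 1:] ^ j * [:g $ 2 $ 2, g $ 1 $ 2:] ^ j"
  have "degree ?p \<le> degree ([:g $ 2 $ 1, g $ 1 $ 1:] ^ j) + degree ([:g $ 2 $ 2, g $ 1 $ 2:] ^ j)"
    by (rule degree_mult_le)
  also have "\<dots> \<le> degree [:g $ 2 $ 1, g $ 1 $ 1:] * j + degree [:g $ 2 $ 2, g $ 1 $ 2:] * j"
    by (intro add_mono degree_power_le)
  also have "\<dots> \<le> 1 * j + 1 * j"
    by (intro add_mono mult_right_mono) auto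
  finally have "degree ?p \<le> 2 * j" by simp
  hence "poly ?p 1 = (\<Sum>l\<le>2 * j. coeff ?p l * 1 ^ l)"
    unfolding poly_altdef by (intro sum.mono_neutral_left) (auto simp: coeff_eq_0)
  thus ?thesis
    by (simp add: mcoeff_def power_mult_distrib add_ac)
qed

section \<open>Left translations and the vanishing of integrals\<close>

lemma SU2_mult: "g \<in> SU2 \<Longrightarrow> h \<in> SU2 \<Longrightarrow> g ** h \<in> SU2"
proof -
  assume g: "g \<in> SU2" and h: "h \<in> SU2"
  have "(\<chi> i j. cnj ((g ** h) $ j $ i)) = (\<chi> i j. cnj (h $ j $ i)) ** (\<chi> i j. cnj (g $ j $ i))"
    by (simp add: vec_eq_iff matrix_matrix_mult_def mult.commute)
  hence "(g ** h) ** (\<chi> i j. cnj ((g ** h) $ j $ i)) =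
      g ** (h ** (\<chi> i j. cnj (h $ j $ i))) ** (\<chi> i j. cnj (g $ j $ i))"
    by (simp only: matrix_mul_assoc)
  thus ?thesis using g h by (simp add: SU2_def det_mul)
qed

lemma SU2_I:
  assumes "h $ 2 $ 2 = cnj (h $ 1 $ 1)" "h $ 2 $ 1 = - cnj (h $ 1 $ 2)"
    "h $ 1 $ 1 * cnj (h $ 1 $ 1) + h $ 1 $ 2 * cnj (h $ 1 $ 2) = 1"
  shows "h \<in> SU2"
  using assms
  by (auto simp: SU2_def vec_eq_iff forall_2 matrix_matrix_mult_def sum_2 mat_def det_2 algebra_simps)

locale haar_SU2 =
  fixes M :: "(complex ^ 2 ^ 2) measure"
  assumes haar: "normalized_haar_SU2 M"
begin

sublocale prob_space M
  using haar by (simp add: normalized_haar_SU2_def)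

lemma sets_M: "sets M = sets (restrict_space borel SU2)"
  using haar by (simp add: normalized_haar_SU2_def)

lemma space_M: "space M = SU2"
  using sets_eq_imp_space_eq[OF sets_M] by (simp add: space_restrict_space)

lemma measurable_continuous:
  fixes f :: "complex ^ 2 ^ 2 \<Rightarrow> 'b::topological_space"
  assumes "continuous_on UNIV f"
  shows "f \<in> borel_measurable M"
  using borel_measurable_continuous_onI[OF assms] measurable_restrict_space1
    measurable_cong_sets[OF sets_M refl] by blast

lemma integral_mult_left_invariant:
  fixes f :: "complex ^ 2 ^ 2 \<Rightarrow> complex"
  assumes h: "h \<in> SU2" and f: "f \<in> borel_measurable M"
  shows "(LINT g|M. f (h ** g)) = (LINT g|M. f g)"
proof -
  have "continuous_on UNIV (\<lambda>g. h ** g)"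
    unfolding matrix_matrix_mult_def by (intro continuous_intros)
  hence "(\<lambda>g. h ** g) \<in> measurable M borel" by (rule measurable_continuous)
  hence "(\<lambda>g. h ** g) \<in> measurable M (restrict_space borel SU2)"
    by (intro measurable_restrict_space2) (auto simp: space_M SU2_mult[OF h])
  hence m: "(\<lambda>g. h ** g) \<in> measurable M M"
    using measurable_cong_sets[OF refl sets_M] by blast
  have "(LINT g|M. f g) = (LINT g|distr M M (\<lambda>g. h ** g). f g)"
    using haar h by (simp add: normalized_haar_SU2_def)
  also have "\<dots> = (LINT g|M. f (h ** g))"
    by (rule integral_distr[OF m f])
  finally show ?thesis by simp
qed

lemma integrable_mcoeff: "integrable M (\<lambda>g. mcoeff g a b l)"
proof -
  obtain B where "\<forall>g\<in>SU2. cmod (mcoeff g a b l) \<le> B" using mcoeff_bounded by blast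
  thus ?thesis
    by (intro integrable_const_bound[where B=B] measurable_continuous continuous_on_mcoeff)
      (auto simp: space_M)
qed

lemma integral_mcoeff_eq_0:
  assumes "2 * l \<noteq> a + b" and "l \<le> a + b"
  shows "(LINT g|M. mcoeff g a b l) = 0"
proof -
  define d where "d = 2 * real l - real (a + b)"
  have "d \<noteq> 0" using assms(1) unfolding d_def by linarith
  \<comment> \<open>The angle is chosen so that a coefficient of weight d picks up the phase exp (i
    pi) = -1; by invariance its integral equals its own negative.\<close>
  define h :: "complex ^ 2 ^ 2" where
    "h = (\<chi> i j. if i = j then (if i = 1 then cis (pi / d) else cis (- (pi / d))) else 0)"
  have "h \<in> SU2"
    by (rule SU2_I) (simp_all add: h_def cis_cnj cis_mult)
  have "(h $ 1 $ 1) ^ l * (h $ 2 $ 2) ^ (a + b - l) = cis (real l * (pi / d) + real (a + b - l) * (- (pi / d)))"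
    by (simp add: h_def Complex.DeMoivre cis_mult del: of_nat_diff)
  also have "real l * (pi / d) + real (a + b - l) * (- (pi / d)) = (pi / d) * (real l - real (a + b - l))"
    by (simp add: right_diff_distrib mult.commute[of _ pi])
  also have "real l - real (a + b - l) = d"
    using assms(2) by (simp add: d_def of_nat_diff)
  also have "cis (pi / d * d) = -1" using \<open>d \<noteq> 0\<close> by simp
  finally have "mcoeff (h ** g) a b l = - mcoeff g a b l" for g
    by (subst mcoeff_diagonal_mult) (simp_all add: h_def)
  moreover have "(LINT g|M. mcoeff (h ** g) a b l) = (LINT g|M. mcoeff g a b l)"
    by (rule integral_mult_left_invariant[OF \<open>h \<in> SU2\<close>]) (intro measurable_continuous continuous_on_mcoeff)
  ultimately show ?thesis by simp
qed

text \<open>The diagonal translations leave only the row of weight zero; it is killed by comparing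
  the top coefficient at \<open>h g\<close> and at \<open>g\<close>, where \<open>h\<close> is a rotation by \<open>\<pi> / 4\<close>.\<close>
lemma integral_mcoeff_middle:
  assumes "j \<ge> 1"
  shows "(LINT g|M. mcoeff g j j j) = 0"
proof -
  define s :: complex where "s = of_real (sqrt (1 / 2))"
  have s: "s * s = 1 / 2" and "cnj s = s" unfolding s_def of_real_mult[symmetric] by simp_all
  define h :: "complex ^ 2 ^ 2" where "h = (\<chi> i j. if i = 2 \<and> j = 1 then - s else s)"
  have "h \<in> SU2"
    by (rule SU2_I) (simp_all add: h_def s \<open>cnj s = s\<close>)
  have "mcoeff (h ** g) j j (2 * j) = (s * s) ^ j * (\<Sum>l\<le>2 * j. mcoeff g j j l)" for g
    unfolding mcoeff_top sum_mcoeff power_mult_distrib[symmetric]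
    by (simp add: h_def matrix_matrix_mult_def sum_2 algebra_simps)
  hence "(LINT g|M. mcoeff (h ** g) j j (2 * j)) = (s * s) ^ j * (\<Sum>l\<le>2 * j. LINT g|M. mcoeff g j j l)"
    by (simp add: integrable_mcoeff)
  also have "(\<Sum>l\<le>2 * j. LINT g|M. mcoeff g j j l) = (\<Sum>l\<in>{j}. LINT g|M. mcoeff g j j l)"
    by (rule sum.mono_neutral_right) (auto intro!: integral_mcoeff_eq_0)
  also have "(LINT g|M. mcoeff (h ** g) j j (2 * j)) = (LINT g|M. mcoeff g j j (2 * j))"
    by (rule integral_mult_left_invariant[OF \<open>h \<in> SU2\<close>]) (intro measurable_continuous continuous_on_mcoeff)
  also have "\<dots> = 0"
    using assms by (intro integral_mcoeff_eq_0) auto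
  finally show ?thesis by (simp add: s)
qed

lemma spin_char_mcoeff: "spin_char j g = (\<Sum>k\<le>2 * j. Re (mcoeff g k (2 * j - k) k))"
  by (simp add: spin_char_def spin_matrix_def mcoeff_def)

lemma integrable_spin_char: "integrable M (spin_char j)"
  unfolding spin_char_mcoeff[abs_def] by (intro Bochner_Integration.integrable_sum integrable_Re integrable_mcoeff)

lemma borel_measurable_spin_char [measurable]: "spin_char j \<in> borel_measurable M"
  using integrable_spin_char by blast

lemma spin_char_bounded: "\<exists>B. \<forall>g\<in>SU2. \<bar>spin_char j g\<bar> \<le> B"
proof -
  have "\<forall>k. \<exists>B. \<forall>g\<in>SU2. cmod (mcoeff g k (2 * j - k) k) \<le> B"
    using mcoeff_bounded by blast
  then obtain B where B: "\<forall>k. \<forall>g\<in>SU2. cmod (mcoeff g k (2 * j - k) k) \<le> B k"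
    by (rule choice[THEN exE])
  have "\<bar>spin_char j g\<bar> \<le> (\<Sum>k\<le>2 * j. B k)" if "g \<in> SU2" for g
    unfolding spin_char_mcoeff
    by (rule order_trans[OF sum_abs sum_mono]) (use B that abs_Re_le_cmod order_trans in blast)
  thus ?thesis by blast
qed

lemma integral_spin_char: "(LINT g|M. spin_char j g) = (if j = 0 then 1 else 0)"
proof (cases "j = 0")
  case True
  have "(LINT g|M. spin_char 0 g) = (LINT g|M. 1)"
    by (rule Bochner_Integration.integral_cong) (auto simp: space_M spin_char_0)
  thus ?thesis using True prob_space by simp
next
  case False
  \<comment> \<open>The k-th diagonal entry has weight 2 k - 2 j, so only the middle one escapes the
    diagonal translations.\<close>
  have "(LINT g|M. mcoeff g k (2 * j - k) k) = 0" if "k \<le> 2 * j" for k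
  proof (cases "k = j")
    case True
    thus ?thesis using integral_mcoeff_middle[of j] False by (simp add: mult_2)
  qed (use that in \<open>auto intro!: integral_mcoeff_eq_0\<close>)
  hence "(LINT g|M. Re (mcoeff g k (2 * j - k) k)) = 0" if "k \<le> 2 * j" for k
    using that by (simp add: integral_Re integrable_mcoeff)
  thus ?thesis
    using False by (simp add: spin_char_mcoeff integrable_mcoeff)
qed

end

subsection \<open>Multiplicities in tensor powers of the adjoint representation\<close>

text \<open>Counts paths of n steps -1, 0, 1 from 0 to j that stay nonnegative and have no flat step
  at height 0 (Riordan numbers for j = 0): spin 0 tensored with spin 1 contains only spin 1.\<close>

fun adj_mult :: "nat \<Rightarrow> nat \<Rightarrow> nat" where
  "adj_mult 0 0 = 1"
| "adj_mult 0 (Suc j) = 0"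
| "adj_mult (Suc n) 0 = adj_mult n 1"
| "adj_mult (Suc n) (Suc j) = adj_mult n j + adj_mult n (Suc j) + adj_mult n (Suc (Suc j))"

lemma adj_mult_le: "adj_mult n j \<le> 3 ^ n"
proof (induction n arbitrary: j)
  case 0
  thus ?case by (cases j) auto
next
  case (Suc n)
  show ?case
  proof (cases j)
    case 0
    thus ?thesis using Suc[of 1] by simp
  next
    case [simp]: (Suc i)
    show ?thesis using Suc.IH[of i] Suc.IH[of "Suc i"] Suc.IH[of "Suc (Suc i)"] by simp
  qed
qed

lemma adj_mult_eq_0: "n < j \<Longrightarrow> adj_mult n j = 0"
proof (induction n arbitrary: j)
  case 0
  thus ?case by (cases j) auto
next
  case (Suc n)
  thus ?case by (cases j) auto
qed

text \<open>The transfer principle between the two measures; r is the total mass, 1 for Haar measure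
  and 2 pi for the circle.\<close>

lemma adj_mult_unique:
  fixes b :: "nat \<Rightarrow> nat \<Rightarrow> real"
  assumes "\<And>j. b 0 j = (if j = 0 then r else 0)"
    and "\<And>n. b (Suc n) 0 = b n 1"
    and "\<And>n j. b (Suc n) (Suc j) = b n j + b n (Suc j) + b n (Suc (Suc j))"
  shows "b n j = r * real (adj_mult n j)"
proof (induction n arbitrary: j)
  case 0
  thus ?case by (cases j) (auto simp: assms)
next
  case (Suc n)
  show ?case by (cases j) (auto simp: assms Suc algebra_simps)
qed

lemma adj_mult_0_0: "adj_mult 0 j = (if j = 0 then 1 else 0)"
  by (cases j) auto

text \<open>Stated for an arbitrary finite measure because it expands the exponential both under the
  Haar integral and under the circle integrals.\<close>

lemma (in finite_measure) sums_integral_exp: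
  fixes u f :: "'a \<Rightarrow> real"
  assumes [measurable]: "u \<in> borel_measurable M" "f \<in> borel_measurable M"
    and u: "\<And>w. w \<in> space M \<Longrightarrow> \<bar>u w\<bar> \<le> B" and f: "\<And>w. w \<in> space M \<Longrightarrow> \<bar>f w\<bar> \<le> R"
  shows "(\<lambda>n. (LINT w|M. u w * f w ^ n) * (x ^ n / fact n)) sums (LINT w|M. u w * exp (x * f w))"
proof -
  \<comment> \<open>On an empty space the hypotheses allow negative B and R; cutting off at 0
    restores the signs needed to multiply bounds.\<close>
  define B' where "B' = max B 0"
  define R' where "R' = max R 0"
  have u': "\<bar>u w\<bar> \<le> B'" and f': "\<bar>f w\<bar> \<le> R'" if "w \<in> space M" for w
    using u[OF that] f[OF that] by (auto simp: B'_def R'_def)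
  have nn: "B' \<ge> 0" "R' \<ge> 0" by (auto simp: B'_def R'_def)
  let ?g = "\<lambda>n w. u w * f w ^ n * (x ^ n / fact n)"
  have bd: "norm (?g n w) \<le> B' * ((\<bar>x\<bar> * R') ^ n / fact n)" if "w \<in> space M" for n w
  proof -
    have "\<bar>u w\<bar> * \<bar>f w\<bar> ^ n * (\<bar>x\<bar> ^ n / fact n) \<le> B' * R' ^ n * (\<bar>x\<bar> ^ n / fact n)"
      using u'[OF that] f'[OF that] nn by (intro mult_mono power_mono) auto
    thus ?thesis by (simp add: abs_mult power_abs power_mult_distrib mult_ac)
  qed
  have int: "integrable M (?g n)" for n
    by (rule integrable_const_bound[where B = "B' * ((\<bar>x\<bar> * R') ^ n / fact n)"]) (use bd in auto)
  have S: "summable (\<lambda>n. B' * ((\<bar>x\<bar> * R') ^ n / fact n))"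
    using summable_exp[of "\<bar>x\<bar> * R'"] by (intro summable_mult) (simp add: field_simps)
  have s1: "AE w in M. summable (\<lambda>n. norm (?g n w))"
    by (rule AE_I2) (rule summable_comparison_test'[OF S, of 0], use bd in auto)
  have s2: "summable (\<lambda>n. LINT w|M. norm (?g n w))"
  proof (rule summable_comparison_test'[of "\<lambda>n. measure M (space M) * (B' * ((\<bar>x\<bar> * R') ^ n / fact n))" 0])
    show "summable (\<lambda>n. measure M (space M) * (B' * ((\<bar>x\<bar> * R') ^ n / fact n)))"
      using S by (rule summable_mult)
    fix n
    have "(LINT w|M. norm (?g n w)) \<le> (LINT w|M. B' * ((\<bar>x\<bar> * R') ^ n / fact n))"
      by (rule integral_mono[OF integrable_norm[OF int]]) (use bd in auto)
    moreover have "0 \<le> (LINT w|M. norm (?g n w))" by (intro Bochner_Integration.integral_nonneg) auto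
    ultimately show "norm (LINT w|M. norm (?g n w)) \<le> measure M (space M) * (B' * ((\<bar>x\<bar> * R') ^ n / fact n))"
      by simp
  qed
  have "(\<lambda>n. LINT w|M. ?g n w) sums (LINT w|M. (\<Sum>n. ?g n w))"
    unfolding integral_suminf[OF int s1 s2] by (rule summable_sums[OF summable_integral[OF int s1 s2]])
  also have "(\<lambda>w. \<Sum>n. ?g n w) = (\<lambda>w. u w * exp (x * f w))"
  proof
    fix w
    have "(\<lambda>n. u w * ((x * f w) ^ n / fact n)) sums (u w * exp (x * f w))"
      using sums_mult[OF exp_converges[of "x * f w"], of "u w"] by (simp add: scaleR_conv_of_real field_simps)
    moreover have "(\<lambda>n. u w * ((x * f w) ^ n / fact n)) = (\<lambda>n. ?g n w)"
      by (simp add: fun_eq_iff power_mult_distrib)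
    ultimately show "(\<Sum>n. ?g n w) = u w * exp (x * f w)" by (metis sums_unique)
  qed
  finally show ?thesis by (simp only: integral_mult_left_zero)
qed

context haar_SU2
begin

lemma integrable_char_power: "integrable M (\<lambda>g. spin_char j g * spin_char 1 g ^ n)"
proof -
  obtain B where B: "\<forall>g\<in>SU2. \<bar>spin_char j g\<bar> \<le> B" using spin_char_bounded by blast
  show ?thesis
  proof (rule integrable_const_bound)
    show "AE g in M. norm (spin_char j g * spin_char 1 g ^ n) \<le> B * 5 ^ n"
    proof (rule AE_I2)
      fix g assume "g \<in> space M"
      hence g: "g \<in> SU2" by (simp add: space_M)
      have "\<bar>spin_char j g\<bar> * \<bar>spin_char 1 g\<bar> ^ n \<le> B * 5 ^ n"
        using B[rule_format, OF g] spin_char_1_bound[OF g] by (intro mult_mono power_mono) auto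
      thus "norm (spin_char j g * spin_char 1 g ^ n) \<le> B * 5 ^ n" by (simp add: abs_mult power_abs)
    qed
  qed measurable
qed

lemma integral_char_power:
  "(LINT g|M. spin_char j g * spin_char 1 g ^ n) = real (adj_mult n j)"
proof -
  define b where "b n j = (LINT g|M. spin_char j g * spin_char 1 g ^ n)" for n j
  have "b n j = 1 * real (adj_mult n j)"
  proof (rule adj_mult_unique)
    show "b 0 j = (if j = 0 then 1 else 0)" for j
      using integral_spin_char[of j] by (simp add: b_def)
    show "b (Suc n) 0 = b n 1" for n
      unfolding b_def by (rule Bochner_Integration.integral_cong) (auto simp: space_M spin_char_0)
    fix n j
    have "b (Suc n) (Suc j) = (LINT g|M. spin_char j g * spin_char 1 g ^ n +
        spin_char (Suc j) g * spin_char 1 g ^ n + spin_char (Suc (Suc j)) g * spin_char 1 g ^ n)"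
      unfolding b_def
    proof (rule Bochner_Integration.integral_cong)
      fix g assume "g \<in> space M"
      hence "g \<in> SU2" by (simp add: space_M)
      have "spin_char (Suc j) g * spin_char 1 g ^ Suc n = spin_char 1 g * spin_char (Suc j) g * spin_char 1 g ^ n"
        by simp
      thus "spin_char (Suc j) g * spin_char 1 g ^ Suc n = spin_char j g * spin_char 1 g ^ n +
        spin_char (Suc j) g * spin_char 1 g ^ n + spin_char (Suc (Suc j)) g * spin_char 1 g ^ n"
        unfolding spin_char_Suc_Suc[OF \<open>g \<in> SU2\<close>] by (simp add: algebra_simps)
    qed simp
    thus "b (Suc n) (Suc j) = b n j + b n (Suc j) + b n (Suc (Suc j))"
      unfolding b_def using integrable_char_power by simp
  qed
  thus ?thesis by (simp add: b_def)
qed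

section \<open>The finite-L coefficients and their square sums\<close>

lemma a_coeff_eq:
  "a_coeff M L j y = (\<Sum>n\<le>L. real (L choose n) * y ^ n * real (adj_mult n j))"
proof -
  have "a_coeff M L j y = (LINT g|M. (\<Sum>n\<le>L. real (L choose n) * y ^ n * (spin_char j g * spin_char 1 g ^ n)))"
    unfolding a_coeff_def add.commute[of 1] binomial_ring
    by (simp add: sum_distrib_left power_mult_distrib mult_ac)
  also have "\<dots> = (\<Sum>n\<le>L. real (L choose n) * y ^ n * real (adj_mult n j))"
    using integrable_char_power by (subst Bochner_Integration.integral_sum) (auto simp: integral_char_power simp del: One_nat_def)
  finally show ?thesis .
qed

lemma A_coeff_sums: "(\<lambda>n. real (adj_mult n j) * (x ^ n / fact n)) sums A_coeff M j x"
proof -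
  obtain B where B: "\<forall>g\<in>SU2. \<bar>spin_char j g\<bar> \<le> B" using spin_char_bounded by blast
  show ?thesis
    using sums_integral_exp[of "spin_char j" "spin_char 1" B 5 x] B spin_char_1_bound
    by (simp add: integral_char_power space_M A_coeff_def del: One_nat_def)
qed

lemma integrable_char_mult_power: "integrable M (\<lambda>g. spin_char j g * (1 + y * spin_char 1 g) ^ L)"
proof -
  have "spin_char j g * (1 + y * spin_char 1 g) ^ L =
      (\<Sum>n\<le>L. real (L choose n) * y ^ n * (spin_char j g * spin_char 1 g ^ n))" for g
    unfolding add.commute[of 1] binomial_ring
    by (simp add: sum_distrib_left power_mult_distrib mult_ac)
  thus ?thesis using integrable_char_power by simp
qed

lemma a_coeff_Suc_0: "a_coeff M (Suc L) 0 y = a_coeff M L 0 y + y * a_coeff M L 1 y"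
proof -
  let ?f = "\<lambda>g. (1 + y * spin_char 1 g) ^ L"
  have "a_coeff M (Suc L) 0 y = (LINT g|M. spin_char 0 g * ?f g + y * (spin_char 1 g * ?f g))"
    unfolding a_coeff_def
    by (intro Bochner_Integration.integral_cong refl) (simp add: space_M spin_char_0 algebra_simps)
  thus ?thesis
    unfolding a_coeff_def using integrable_char_mult_power by simp
qed

lemma a_coeff_Suc_Suc:
  "a_coeff M (Suc L) (Suc j) y = a_coeff M L (Suc j) y +
     y * (a_coeff M L j y + a_coeff M L (Suc j) y + a_coeff M L (Suc (Suc j)) y)"
proof -
  let ?f = "\<lambda>g. (1 + y * spin_char 1 g) ^ L"
  have "a_coeff M (Suc L) (Suc j) y = (LINT g|M. spin_char (Suc j) g * ?f g +
      y * (spin_char j g * ?f g + spin_char (Suc j) g * ?f g + spin_char (Suc (Suc j)) g * ?f g))"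
    unfolding a_coeff_def
  proof (intro Bochner_Integration.integral_cong refl)
    fix g assume "g \<in> space M"
    hence g: "g \<in> SU2" by (simp add: space_M)
    have "spin_char (Suc j) g * (1 + y * spin_char 1 g) ^ Suc L =
        spin_char (Suc j) g * ?f g + y * ((spin_char 1 g * spin_char (Suc j) g) * ?f g)"
      by (simp add: algebra_simps)
    thus "spin_char (Suc j) g * (1 + y * spin_char 1 g) ^ Suc L = spin_char (Suc j) g * ?f g +
      y * (spin_char j g * ?f g + spin_char (Suc j) g * ?f g + spin_char (Suc (Suc j)) g * ?f g)"
      unfolding spin_char_Suc_Suc[OF g] by (simp add: algebra_simps)
  qed
  thus ?thesis
    unfolding a_coeff_def using integrable_char_mult_power by simp
qed

lemma a_coeff_0: "a_coeff M 0 j y = (if j = 0 then 1 else 0)"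
  by (simp add: a_coeff_eq adj_mult_0_0)

lemma a_coeff_eq_0: "L < j \<Longrightarrow> a_coeff M L j y = 0"
  by (simp add: a_coeff_eq adj_mult_eq_0)

lemma a_coeff_nonneg: "0 \<le> y \<Longrightarrow> 0 \<le> a_coeff M L j y"
  unfolding a_coeff_eq by (intro sum_nonneg) auto

lemma a_coeff_0_ge_1:
  assumes "0 \<le> y"
  shows "1 \<le> a_coeff M L 0 y"
proof -
  have "(\<Sum>n\<in>{0}. real (L choose n) * y ^ n * real (adj_mult n 0)) \<le> a_coeff M L 0 y"
    unfolding a_coeff_eq using assms by (intro sum_mono2) auto
  thus ?thesis by simp
qed

text \<open>Discrete Wronskian: multiplication by \<open>\<chi>\<^sub>1\<close> acts on coefficient sequences as a Jacobi matrix.\<close>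
lemma a_coeff_wronskian:
  "(\<Sum>k\<le>N. a_coeff M (Suc L) k y * a_coeff M K k y - a_coeff M L k y * a_coeff M (Suc K) k y) =
     y * (a_coeff M L (Suc N) y * a_coeff M K N y - a_coeff M L N y * a_coeff M K (Suc N) y)"
proof (induction N)
  case 0
  show ?case by (simp add: a_coeff_Suc_0 algebra_simps)
next
  case (Suc N)
  show ?case unfolding sum.atMost_Suc Suc a_coeff_Suc_Suc by (simp add: algebra_simps)
qed

text \<open>Passing one factor from L to K does not change the sum, because the Wronskian boundary
  term lies beyond both supports. At L = 0 only the summand k = 0 survives.\<close>

lemma sum_a_coeff_mult:
  assumes "L + K < N"
  shows "(\<Sum>k\<le>N. a_coeff M L k y * a_coeff M K k y) = a_coeff M (L + K) 0 y"
  using assms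
proof (induction L arbitrary: K)
  case 0
  have "(\<Sum>k\<le>N. a_coeff M 0 k y * a_coeff M K k y) = (\<Sum>k\<in>{0}. a_coeff M 0 k y * a_coeff M K k y)"
    by (rule sum.mono_neutral_right) (auto simp: a_coeff_0)
  thus ?case by (simp add: a_coeff_0)
next
  case (Suc L)
  have "(\<Sum>k\<le>N. a_coeff M (Suc L) k y * a_coeff M K k y) - (\<Sum>k\<le>N. a_coeff M L k y * a_coeff M (Suc K) k y) = 0"
    using Suc.prems by (simp add: sum_subtractf[symmetric] a_coeff_wronskian a_coeff_eq_0)
  thus ?case using Suc.IH[of "Suc K"] Suc.prems by simp
qed

lemma sum_a_coeff_squared: "(\<Sum>k\<le>L. (a_coeff M L k y)\<^sup>2) = a_coeff M (2 * L) 0 y"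
proof -
  have "(\<Sum>k\<le>L. (a_coeff M L k y)\<^sup>2) = (\<Sum>k\<le>Suc (L + L). a_coeff M L k y * a_coeff M L k y)"
    by (rule sum.mono_neutral_cong_left) (auto simp: a_coeff_eq_0 power2_eq_square)
  also have "\<dots> = a_coeff M (L + L) 0 y"
    by (rule sum_a_coeff_mult) simp
  finally show ?thesis by (simp add: mult_2)
qed

end

subsection \<open>Trigonometric integrals and Bessel functions\<close>

abbreviation circle_measure :: "real measure" where
  "circle_measure \<equiv> restrict_space lborel {-pi..pi}"

lemma finite_measure_circle: "finite_measure circle_measure"
  by (rule finite_measureI) (simp add: emeasure_restrict_space)

lemma integrable_circle:
  fixes f :: "real \<Rightarrow> real"
  assumes "continuous_on UNIV f"
  shows "integrable circle_measure f"
  using borel_integrable_compact[of "{-pi..pi}" f] continuous_on_subset[OF assms]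
  by (subst integrable_restrict_space) (auto simp: indicator_scaleR_eq_if if_distrib cong: if_cong)

lemma integral_circle_cos: "(LINT t|circle_measure. cos (real n * t)) = (if n = 0 then 2 * pi else 0)"
proof (cases "n = 0")
  case True
  thus ?thesis by (simp add: measure_restrict_space)
next
  case False
  have "has_bochner_integral lborel (\<lambda>t. cos (real n * t) * indicator {-pi..pi} t)
      (sin (real n * pi) / n - sin (real n * (-pi)) / n)"
    by (rule has_bochner_integral_FTC_Icc_real)
      (use False in \<open>auto intro!: derivative_eq_intros simp: field_simps\<close>)
  hence "(LINT t|lborel. cos (real n * t) * indicator {-pi..pi} t) = 0"
    by (simp add: has_bochner_integral_iff sin_npi)
  thus ?thesis using False by (simp add: integral_restrict_space mult.commute)
qed

lemma cos_add_cos: "2 * cos t * cos (real (Suc j) * t) = cos (real (Suc (Suc j)) * t) + cos (real j * t)"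
proof -
  have "cos (real (Suc j) * t + t) + cos (real (Suc j) * t - t) = 2 * cos t * cos (real (Suc j) * t)"
    by (simp add: cos_add cos_diff)
  thus ?thesis by (simp add: algebra_simps)
qed

text \<open>On the maximal torus chi_j is sin ((j + 1/2) t) / sin (t / 2); multiplied by the Weyl
  density 1 - cos t it becomes cos (j t) - cos ((j + 1) t).\<close>

lemma integral_circle_adj_mult:
  "(LINT t|circle_measure. (cos (real j * t) - cos (real (Suc j) * t)) * (1 + 2 * cos t) ^ n) =
     2 * pi * real (adj_mult n j)"
proof -
  let ?D = "\<lambda>j t. cos (real j * t) - cos (real (Suc j) * t)"
  define b where "b n j = (LINT t|circle_measure. ?D j t * (1 + 2 * cos t) ^ n)" for n j
  have int: "integrable circle_measure (\<lambda>t. ?D j t * (1 + 2 * cos t) ^ n)" for n j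
    by (intro integrable_circle continuous_intros)
  have "b n j = 2 * pi * real (adj_mult n j)"
  proof (rule adj_mult_unique)
    show "b 0 j = (if j = 0 then 2 * pi else 0)" for j
    proof -
      have "b 0 j = (LINT t|circle_measure. cos (real j * t)) - (LINT t|circle_measure. cos (real (Suc j) * t))"
        unfolding b_def power_0 mult_1_right
        by (intro Bochner_Integration.integral_diff integrable_circle continuous_intros)
      thus ?thesis by (simp only: integral_circle_cos) simp
    qed
    fix n
    \<comment> \<open>The boundary rule of \<open>adj_mult\<close> is the identity (1 + 2 c) (1 - c)
      = c - (2 c^2 - 1) with c = cos t.\<close>
    have "(1 + 2 * cos t) * ?D 0 t = ?D 1 t" for t
      using cos_add_cos[of t 0] by (simp add: algebra_simps)
    hence "?D 0 t * (1 + 2 * cos t) ^ Suc n = ?D 1 t * (1 + 2 * cos t) ^ n" for t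
      by (simp only: power_Suc mult.assoc[symmetric] mult.commute[of "?D 0 t"])
    thus "b (Suc n) 0 = b n 1" by (simp only: b_def)
    fix j
    have "(1 + 2 * cos t) * ?D (Suc j) t = ?D j t + ?D (Suc j) t + ?D (Suc (Suc j)) t" for t
      using cos_add_cos[of t j] cos_add_cos[of t "Suc j"] by (simp only: ring_distribs)
    moreover have "?D (Suc j) t * (1 + 2 * cos t) ^ Suc n = ((1 + 2 * cos t) * ?D (Suc j) t) * (1 + 2 * cos t) ^ n" for t
      by (simp only: power_Suc mult_ac)
    ultimately have "?D (Suc j) t * (1 + 2 * cos t) ^ Suc n = ?D j t * (1 + 2 * cos t) ^ n +
        ?D (Suc j) t * (1 + 2 * cos t) ^ n + ?D (Suc (Suc j)) t * (1 + 2 * cos t) ^ n" for t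
      by (simp only: distrib_right)
    thus "b (Suc n) (Suc j) = b n j + b n (Suc j) + b n (Suc (Suc j))"
      unfolding b_def by (simp only: Bochner_Integration.integral_add Bochner_Integration.integrable_add int)
  qed
  thus ?thesis by (simp only: b_def)
qed

text \<open>Fourier coefficients of (exp (i t) + exp (- i t))^n. In real form they obey Pascal's
  rule, reflected at j = 0 because cosine is even.\<close>

lemma integral_circle_cos_power:
  "(LINT t|circle_measure. cos (real j * t) * (2 * cos t) ^ n) =
     2 * pi * (if j \<le> n \<and> even (n - j) then real (n choose ((n - j) div 2)) else 0)"
proof -
  define b where "b n j = (LINT t|circle_measure. cos (real j * t) * (2 * cos t) ^ n)" for n j
  have int: "integrable circle_measure (\<lambda>t. cos (real j * t) * (2 * cos t) ^ n)" for n j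
    by (intro integrable_circle continuous_intros)
  have b0: "b 0 j = (if j = 0 then 2 * pi else 0)" for j
    by (simp only: b_def power_0 mult_1_right integral_circle_cos)
  have b1: "b (Suc n) 0 = 2 * b n 1" for n
    by (simp add: b_def mult.assoc)
  have b2: "b (Suc n) (Suc j) = b n (Suc (Suc j)) + b n j" for n j
  proof -
    have "cos (real (Suc j) * t) * (2 * cos t) ^ Suc n =
        cos (real (Suc (Suc j)) * t) * (2 * cos t) ^ n + cos (real j * t) * (2 * cos t) ^ n" for t
    proof -
      have "cos (real (Suc j) * t) * (2 * cos t) ^ Suc n = 2 * cos t * cos (real (Suc j) * t) * (2 * cos t) ^ n"
        by simp
      thus ?thesis by (simp only: cos_add_cos distrib_right)
    qed
    thus ?thesis
      unfolding b_def by (simp only: Bochner_Integration.integral_add int)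
  qed
  define B where "B n j = (if j \<le> n \<and> even (n - j) then real (n choose ((n - j) div 2)) else 0)" for n j :: nat
  have "b n j = 2 * pi * B n j"
  proof (induction n arbitrary: j)
    case 0
    thus ?case by (simp add: b0 B_def)
  next
    case (Suc n)
    show ?case
    proof (cases j)
      case [simp]: 0
      \<comment> \<open>The reflection doubles the term: a central binomial coefficient is the sum
        of two equal neighbors in the row above.\<close>
      have "B (Suc n) 0 = 2 * B n 1"
      proof (cases "even (Suc n)")
        case True
        then obtain m where m: "Suc n = 2 * m" by blast
        then obtain k where k: "m = Suc k" by (cases m) auto
        hence n: "n = Suc (2 * k)" using m by simp
        have "(Suc (2 * k) choose Suc k) = (Suc (2 * k) choose k)"
          using binomial_symmetric[of k "Suc (2 * k)"] by (simp add: Suc_diff_le)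
        thus ?thesis by (simp add: B_def n)
      qed (auto simp: B_def)
      thus ?thesis by (simp add: b1 Suc)
    next
      case [simp]: (Suc i)
      have "B (Suc n) (Suc i) = B n (Suc (Suc i)) + B n i"
      proof (cases "i \<le> n \<and> even (n - i)")
        case True
        then obtain m where m: "n = i + 2 * m"
          by (metis dvdE le_add_diff_inverse)
        show ?thesis
        proof (cases m)
          case 0
          thus ?thesis using m by (simp add: B_def)
        next
          case (Suc k)
          have "n = Suc (Suc i) + 2 * k" using m Suc by simp
          thus ?thesis using m Suc by (simp add: B_def)
        qed
      next
        case False
        thus ?thesis by (auto simp: B_def)
      qed
      thus ?thesis by (simp add: b2 Suc.IH algebra_simps)
    qed
  qed
  thus ?thesis by (simp only: b_def B_def)
qed

text \<open>Only the powers n = 2 m + j have a nonzero j-th Fourier coefficient; reindexing along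
  them yields the series of \<open>bessel_I\<close>.\<close>

lemma bessel_I_circle:
  "(LINT t|circle_measure. cos (real j * t) * exp (x * (2 * cos t))) = 2 * pi * bessel_I j (2 * x)"
proof -
  let ?c = "\<lambda>n. if j \<le> n \<and> even (n - j) then real (n choose ((n - j) div 2)) else 0"
  have "(\<lambda>n. (LINT t|circle_measure. cos (real j * t) * (2 * cos t) ^ n) * (x ^ n / fact n)) sums
      (LINT t|circle_measure. cos (real j * t) * exp (x * (2 * cos t)))"
    by (rule finite_measure.sums_integral_exp[OF finite_measure_circle, where B = 1 and R = 2])
      (auto simp: measurable_restrict_space1 abs_mult)
  hence *: "(\<lambda>n. 2 * pi * ?c n * (x ^ n / fact n)) sums
      (LINT t|circle_measure. cos (real j * t) * exp (x * (2 * cos t)))"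
    by (simp only: integral_circle_cos_power)
  define g where "g m = 2 * m + j" for m :: nat
  have "strict_mono g" by (rule strict_monoI) (simp add: g_def)
  moreover have "2 * pi * ?c n * (x ^ n / fact n) = 0" if "n \<notin> range g" for n
  proof -
    have "\<not> (j \<le> n \<and> even (n - j))"
    proof
      assume "j \<le> n \<and> even (n - j)"
      then obtain m where "n - j = 2 * m" "j \<le> n" by blast
      hence "n = g m" by (simp add: g_def)
      thus False using that by blast
    qed
    thus ?thesis by (simp only: if_False)
  qed
  ultimately have "(\<lambda>m. 2 * pi * ?c (g m) * (x ^ g m / fact (g m))) sums
      (LINT t|circle_measure. cos (real j * t) * exp (x * (2 * cos t)))"
    using * sums_mono_reindex[of g "\<lambda>n. 2 * pi * ?c n * (x ^ n / fact n)"] by blast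
  moreover have "2 * pi * ?c (g m) * (x ^ g m / fact (g m)) = 2 * pi * ((2 * x / 2) ^ (2 * m + j) / (fact m * fact (m + j)))" for m
  proof -
    have "real (2 * m + j choose m) / fact (2 * m + j) = 1 / (fact m * fact (m + j))"
      using binomial_fact[of m "2 * m + j", where 'a=real] by (simp add: mult_2)
    thus ?thesis by (simp add: g_def field_simps)
  qed
  ultimately have S: "(\<lambda>m. 2 * pi * ((2 * x / 2) ^ (2 * m + j) / (fact m * fact (m + j)))) sums
      (LINT t|circle_measure. cos (real j * t) * exp (x * (2 * cos t)))"
    by simp
  \<comment> \<open>Convergence of the Bessel series is inherited from the expansion of the
    integral.\<close>
  have "summable (\<lambda>m. (2 * x / 2) ^ (2 * m + j) / (fact m * fact (m + j)))"
    using sums_summable[OF S] by (subst (asm) summable_cmult_iff) simp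
  from sums_mult[OF summable_sums[OF this], of "2 * pi"] show ?thesis
    using S sums_unique2 unfolding bessel_I_def by blast
qed

definition bessel_diff :: "nat \<Rightarrow> real \<Rightarrow> real" where
  "bessel_diff j x = bessel_I j x - bessel_I (Suc j) x"

lemma bessel_diff_circle:
  "(LINT t|circle_measure. (cos (real j * t) - cos (real (Suc j) * t)) * exp (x * (2 * cos t))) =
     2 * pi * bessel_diff j (2 * x)"
proof -
  have int: "integrable circle_measure (\<lambda>t. cos (real j * t) * exp (x * (2 * cos t)))" for j
    by (intro integrable_circle continuous_intros)
  show ?thesis
    by (simp only: left_diff_distrib Bochner_Integration.integral_diff int bessel_I_circle bessel_diff_def right_diff_distrib)
qed

context haar_SU2
begin

text \<open>Both sides expand into the same series with coefficients \<open>adj_mult n j\<close>;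
  the factor exp x is the constant 1 in 1 + 2 cos t.\<close>

lemma A_coeff_bessel: "A_coeff M j x = exp x * bessel_diff j (2 * x)"
proof -
  let ?D = "\<lambda>t. cos (real j * t) - cos (real (Suc j) * t)"
  have D: "\<bar>?D t\<bar> \<le> 2" for t
    using abs_cos_le_one[of "real j * t"] abs_cos_le_one[of "real (Suc j) * t"] by linarith
  have c: "\<bar>1 + 2 * cos t\<bar> \<le> 3" for t :: real
    using abs_cos_le_one[of t] by linarith
  have "(\<lambda>n. (LINT t|circle_measure. ?D t * (1 + 2 * cos t) ^ n) * (x ^ n / fact n)) sums
      (LINT t|circle_measure. ?D t * exp (x * (1 + 2 * cos t)))"
    by (rule finite_measure.sums_integral_exp[OF finite_measure_circle, where B = 2 and R = 3])
      (auto simp: measurable_restrict_space1 D c simp del: of_nat_Suc)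
  hence "(\<lambda>n. 2 * pi * (real (adj_mult n j) * (x ^ n / fact n))) sums
      (LINT t|circle_measure. ?D t * exp (x * (1 + 2 * cos t)))"
    by (simp only: integral_circle_adj_mult mult.assoc)
  hence "(LINT t|circle_measure. ?D t * exp (x * (1 + 2 * cos t))) = 2 * pi * A_coeff M j x"
    using sums_mult[OF A_coeff_sums[of j x], of "2 * pi"] sums_unique2 by blast
  also have "(\<lambda>t. ?D t * exp (x * (1 + 2 * cos t))) = (\<lambda>t. exp x * (?D t * exp (x * (2 * cos t))))"
    by (simp only: distrib_left exp_add mult_1_right mult.left_commute)
  also have "(LINT t|circle_measure. exp x * (?D t * exp (x * (2 * cos t)))) = exp x * (2 * pi * bessel_diff j (2 * x))"
    by (simp only: integral_mult_right_zero bessel_diff_circle)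
  finally show ?thesis by simp
qed

end

subsection \<open>The limit of the normalized sums\<close>

context haar_SU2
begin

lemma A_coeff_nonneg: "0 \<le> x \<Longrightarrow> 0 \<le> A_coeff M j x"
  by (rule sums_le[OF _ sums_zero A_coeff_sums]) auto

text \<open>The factor 6 is 3 * 2: multiplicities are at most 3^n and vanish for n < j, so a factor
  2^(n - j) may be inserted. It buys geometric decay in j.\<close>

lemma A_coeff_le:
  assumes "0 \<le> x"
  shows "A_coeff M j x \<le> exp (6 * x) / 2 ^ j"
proof (rule sums_le[OF _ A_coeff_sums])
  show "(\<lambda>n. (6 * x) ^ n / fact n / 2 ^ j) sums (exp (6 * x) / 2 ^ j)"
    using sums_divide[OF exp_converges[of "6 * x"], of "2 ^ j"] by (simp add: field_simps)
  fix n
  show "real (adj_mult n j) * (x ^ n / fact n) \<le> (6 * x) ^ n / fact n / 2 ^ j"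
  proof (cases "n < j")
    case True
    thus ?thesis using assms by (simp add: adj_mult_eq_0)
  next
    case False
    have "(3::real) ^ n * 2 ^ j \<le> 3 ^ n * 2 ^ n"
      using False by (intro mult_left_mono power_increasing) auto
    hence "(3::real) ^ n \<le> 6 ^ n / 2 ^ j"
      by (simp add: field_simps power_mult_distrib[symmetric])
    moreover have "real (adj_mult n j) \<le> 3 ^ n"
      using adj_mult_le[of n j] by (metis of_nat_le_iff of_nat_numeral of_nat_power)
    ultimately have "real (adj_mult n j) \<le> 6 ^ n / 2 ^ j" by linarith
    hence "real (adj_mult n j) * (x ^ n / fact n) \<le> 6 ^ n / 2 ^ j * (x ^ n / fact n)"
      using assms by (intro mult_right_mono) auto
    thus ?thesis by (simp add: power_mult_distrib mult.commute)
  qed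
qed

lemma A_minus_a_sums:
  "(\<lambda>n. real (adj_mult n j) * x ^ n * (1 / fact n - real (L choose n) / real L ^ n)) sums
     (A_coeff M j x - a_coeff M L j (x / real L))"
proof -
  have "(\<lambda>n. real (L choose n) * (x / real L) ^ n * real (adj_mult n j)) sums a_coeff M L j (x / real L)"
    unfolding a_coeff_eq by (rule sums_finite) (auto simp: binomial_eq_0)
  from sums_diff[OF A_coeff_sums this] show ?thesis
    by (simp add: power_divide algebra_simps)
qed

text \<open>Makes the series in \<open>A_minus_a_sums\<close> coefficientwise nonnegative. For L = 0
  the convention for division by zero gives 0 when n > 0, so the bound persists.\<close>

lemma binomial_div_power_le: "real (L choose n) / real L ^ n \<le> 1 / fact n"
proof (cases "L = 0")
  case True
  thus ?thesis by (cases n) auto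
next
  case False
  have "(L choose n) * fact n \<le> L ^ n" by (rule binomial_fact_pow)
  hence "real (L choose n) * fact n \<le> real L ^ n"
    by (metis of_nat_fact of_nat_le_iff of_nat_mult of_nat_power)
  thus ?thesis using False by (simp add: field_simps)
qed

lemma a_coeff_le_A_coeff: "0 \<le> x \<Longrightarrow> a_coeff M L j (x / real L) \<le> A_coeff M j x"
  using sums_le[OF _ sums_zero A_minus_a_sums[of j x L]] binomial_div_power_le[of L] by simp

lemma A_minus_a_mono:
  assumes "0 \<le> x" "x \<le> y"
  shows "A_coeff M j x - a_coeff M L j (x / real L) \<le> A_coeff M j y - a_coeff M L j (y / real L)"
  by (rule sums_le[OF _ A_minus_a_sums A_minus_a_sums])
    (use assms binomial_div_power_le[of L] in \<open>auto intro!: mult_mono power_mono mult_nonneg_nonneg\<close>)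

lemma a_coeff_mono:
  assumes "0 \<le> x" "x \<le> y"
  shows "a_coeff M L j x \<le> a_coeff M L j y"
  unfolding a_coeff_eq using assms
  by (intro sum_mono mult_mono power_mono) auto

lemma A_coeff_mono: "0 \<le> x \<Longrightarrow> x \<le> y \<Longrightarrow> A_coeff M j x \<le> A_coeff M j y"
  by (rule sums_le[OF _ A_coeff_sums A_coeff_sums]) (auto intro!: mult_left_mono divide_right_mono power_mono)

text \<open>Factor as (A - a) (A + a): both factors are nonnegative and increasing.\<close>

lemma A_sq_minus_a_sq_mono:
  assumes "0 \<le> x" "x \<le> y"
  shows "(A_coeff M j x)\<^sup>2 - (a_coeff M L j (x / real L))\<^sup>2 \<le> (A_coeff M j y)\<^sup>2 - (a_coeff M L j (y / real L))\<^sup>2"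
proof -
  have "x / real L \<le> y / real L" using assms by (intro divide_right_mono) auto
  hence "(A_coeff M j x - a_coeff M L j (x / real L)) * (A_coeff M j x + a_coeff M L j (x / real L)) \<le>
      (A_coeff M j y - a_coeff M L j (y / real L)) * (A_coeff M j y + a_coeff M L j (y / real L))"
    using assms a_coeff_le_A_coeff[of y L j]
    by (intro mult_mono A_minus_a_mono add_mono A_coeff_mono a_coeff_mono add_nonneg_nonneg
        A_coeff_nonneg a_coeff_nonneg) auto
  thus ?thesis by (simp add: power2_eq_square algebra_simps)
qed

lemma a_coeff_tendsto:
  assumes "0 \<le> x"
  shows "(\<lambda>L. a_coeff M L j (x / real L)) \<longlonglongrightarrow> A_coeff M j x"
  unfolding a_coeff_def A_coeff_def
proof -
  obtain B where B: "\<forall>g\<in>SU2. \<bar>spin_char j g\<bar> \<le> B" using spin_char_bounded by blast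
  show "(\<lambda>L. LINT g|M. spin_char j g * (1 + x / real L * spin_char 1 g) ^ L) \<longlonglongrightarrow>
      (LINT g|M. spin_char j g * exp (x * spin_char 1 g))"
  \<comment> \<open>With u = 5 x / L, \<open>1 + u \<le> exp u\<close> bounds the L-th power by exp
    (5 x) uniformly in L, also at L = 0, where the quotient is 0.\<close>
  proof (rule integral_dominated_convergence[where w = "\<lambda>_. B * exp (5 * x)"])
    show "(\<lambda>g. spin_char j g * exp (x * spin_char 1 g)) \<in> borel_measurable M"
      "(\<lambda>g. spin_char j g * (1 + x / real L * spin_char 1 g) ^ L) \<in> borel_measurable M" for L
      by measurable
    show "integrable M (\<lambda>_. B * exp (5 * x))" by (rule integrable_const)
    show "AE g in M. (\<lambda>L. spin_char j g * (1 + x / real L * spin_char 1 g) ^ L) \<longlonglongrightarrow>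
        spin_char j g * exp (x * spin_char 1 g)"
      by (intro AE_I2 tendsto_mult tendsto_const)
        (use tendsto_exp_limit_sequentially in \<open>simp add: mult.commute\<close>)
    fix L
    show "AE g in M. norm (spin_char j g * (1 + x / real L * spin_char 1 g) ^ L) \<le> B * exp (5 * x)"
    proof (rule AE_I2)
      fix g assume "g \<in> space M"
      hence g: "g \<in> SU2" by (simp add: space_M)
      have "\<bar>1 + x / real L * spin_char 1 g\<bar> \<le> 1 + x / real L * \<bar>spin_char 1 g\<bar>"
        using assms abs_triangle_ineq[of 1 "x / real L * spin_char 1 g"] by (simp add: abs_mult)
      also have "\<dots> \<le> 1 + x / real L * 5"
        using spin_char_1_bound[OF g] assms by (intro add_left_mono mult_left_mono) auto
      also have "\<dots> \<le> exp (x / real L * 5)" by (rule exp_ge_add_one_self)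
      finally have "\<bar>1 + x / real L * spin_char 1 g\<bar> ^ L \<le> exp (x / real L * 5) ^ L"
        by (intro power_mono) auto
      also have "\<dots> \<le> exp (5 * x)"
        using assms by (cases "L = 0") (simp_all add: exp_of_nat_mult[symmetric])
      finally have "\<bar>spin_char j g\<bar> * \<bar>1 + x / real L * spin_char 1 g\<bar> ^ L \<le> B * exp (5 * x)"
        using B g by (intro mult_mono) auto
      thus "norm (spin_char j g * (1 + x / real L * spin_char 1 g) ^ L) \<le> B * exp (5 * x)"
        by (simp add: abs_mult power_abs)
    qed
  qed
qed

text \<open>The weight is kept general since w = 1 gives the denominators and w = log the
  numerators. The base 4 and the exponent 12 x are the squares of the terms in
  \<open>A_coeff_le\<close>.\<close>

lemma weighted_summable:
  assumes "\<And>j. 0 \<le> w j" "summable (\<lambda>j. w j / 4 ^ j)" "0 \<le> x"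
  shows "summable (\<lambda>j. w j * (A_coeff M j x)\<^sup>2)"
proof (rule summable_comparison_test')
  show "summable (\<lambda>j. exp (12 * x) * (w j / 4 ^ j))" using assms(2) by (rule summable_mult)
  fix j
  have "(A_coeff M j x)\<^sup>2 \<le> (exp (6 * x) / 2 ^ j)\<^sup>2"
    using A_coeff_le[OF assms(3)] A_coeff_nonneg[OF assms(3)] by (intro power_mono)
  also have "\<dots> = exp (12 * x) / 4 ^ j"
    by (simp add: power_divide power_mult_distrib[symmetric] power2_eq_square exp_add[symmetric])
  finally have "w j * (A_coeff M j x)\<^sup>2 \<le> w j * (exp (12 * x) / 4 ^ j)"
    using assms(1) by (intro mult_left_mono)
  thus "norm (w j * (A_coeff M j x)\<^sup>2) \<le> exp (12 * x) * (w j / 4 ^ j)"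
    using assms(1)[of j] by (simp add: abs_mult mult_ac)
qed

text \<open>By \<open>a_coeff_le_A_coeff\<close> the limiting terms themselves serve as the
  dominating series.\<close>

lemma weighted_tendsto:
  assumes "\<And>j. 0 \<le> w j" "summable (\<lambda>j. w j / 4 ^ j)" "0 \<le> x"
  shows "(\<lambda>L. \<Sum>j\<le>L. w j * (a_coeff M L j (x / real L))\<^sup>2) \<longlonglongrightarrow> (\<Sum>j. w j * (A_coeff M j x)\<^sup>2)"
proof -
  have le: "norm (w j * (a_coeff M L j (x / real L))\<^sup>2) \<le> w j * (A_coeff M j x)\<^sup>2" for j L
    using assms a_coeff_le_A_coeff[of x L j] a_coeff_nonneg[of "x / real L" L j]
    by (simp add: abs_mult mult_left_mono power_mono)
  have "(\<lambda>L. \<Sum>j. w j * (a_coeff M L j (x / real L))\<^sup>2) \<longlonglongrightarrow> (\<Sum>j. w j * (A_coeff M j x)\<^sup>2)"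
    using tannerys_theorem[of "\<lambda>j L. w j * (a_coeff M L j (x / real L))\<^sup>2" "\<lambda>j. w j * (A_coeff M j x)\<^sup>2"
        sequentially "\<lambda>j. w j * (A_coeff M j x)\<^sup>2"] le weighted_summable[OF assms]
    by (simp add: tendsto_intros a_coeff_tendsto assms(3) case_prod_unfold)
  also have "(\<lambda>L. \<Sum>j. w j * (a_coeff M L j (x / real L))\<^sup>2) = (\<lambda>L. \<Sum>j\<le>L. w j * (a_coeff M L j (x / real L))\<^sup>2)"
    by (intro ext suminf_finite) (auto simp: a_coeff_eq_0)
  finally show ?thesis .
qed

text \<open>The error is a power series in \<open>x\<close> with nonnegative coefficients, so that pointwise convergence
  at the right endpoint already gives uniform convergence.\<close>
lemma weighted_error:
  assumes "\<And>j. 0 \<le> w j" "summable (\<lambda>j. w j / 4 ^ j)" "0 \<le> x" "x \<le> y"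
  defines "E \<equiv> \<lambda>L x. (\<Sum>j. w j * (A_coeff M j x)\<^sup>2) - (\<Sum>j\<le>L. w j * (a_coeff M L j (x / real L))\<^sup>2)"
  shows "0 \<le> E L x" "E L x \<le> E L y"
proof -
  have S: "(\<lambda>j. w j * ((A_coeff M j x)\<^sup>2 - (a_coeff M L j (x / real L))\<^sup>2)) sums E L x" if "0 \<le> x" for x
    unfolding E_def right_diff_distrib
    by (intro sums_diff summable_sums weighted_summable sums_finite assms that) (auto simp: a_coeff_eq_0)
  show "E L x \<le> E L y"
    by (rule sums_le[OF _ S S]) (use assms A_sq_minus_a_sq_mono in \<open>auto intro!: mult_left_mono\<close>)
  show "0 \<le> E L x"
    by (rule sums_le[OF _ sums_zero S])
      (use assms a_coeff_le_A_coeff a_coeff_nonneg[of "x / real L"] in \<open>auto intro!: mult_nonneg_nonneg power_mono\<close>)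
qed

section \<open>The two weights and the quotient defining F\<close>

lemma summable_one: "summable (\<lambda>j. 1 / 4 ^ j :: real)"
  using summable_geometric[of "1 / 4 :: real"] by (simp add: power_divide)

lemma log_weight_nonneg: "0 \<le> log 2 (2 * real j + 1)"
  by simp

lemma summable_log: "summable (\<lambda>j. log 2 (2 * real j + 1) / 4 ^ j)"
proof (rule summable_comparison_test')
  show "summable (\<lambda>j. 4 * (1 / 2) ^ j :: real)" by (intro summable_mult summable_geometric) simp
  fix j :: nat
  have "ln (2 * real j + 1) \<le> 2 * real j" using ln_add_one_self_le_self[of "2 * real j"] by (simp add: add.commute)
  moreover have "1 / 2 \<le> ln (2::real)" using ln_2_less_1 ln2_ge_two_thirds by linarith
  ultimately have "log 2 (2 * real j + 1) \<le> 2 * real j / (1 / 2)"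
    unfolding log_def by (intro frac_le) auto
  also have "\<dots> \<le> 4 * 2 ^ j" using of_nat_less_two_power[of j, where 'a=real] by simp
  finally have "log 2 (2 * real j + 1) / 4 ^ j \<le> 4 * 2 ^ j / 4 ^ j" by (intro divide_right_mono) auto
  also have "\<dots> = 4 * (1 / 2) ^ j" by (simp add: power_divide[symmetric] power_mult_distrib[symmetric] field_simps)
  finally show "norm (log 2 (2 * real j + 1) / 4 ^ j) \<le> 4 * (1 / 2) ^ j"
    using log_weight_nonneg[of j] by simp
qed

text \<open>The finite square sums have two limits: the series on the left, by Tannery, and A_0(2x),
  because they equal a_(2L,0)(x / L) and x / L = 2 x / (2 L).\<close>

lemma sums_A_coeff_squared:
  assumes "0 \<le> x"
  shows "(\<lambda>k. (A_coeff M k x)\<^sup>2) sums A_coeff M 0 (2 * x)"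
proof -
  have s: "summable (\<lambda>k. (A_coeff M k x)\<^sup>2)"
    using weighted_summable[of "\<lambda>_. 1", OF _ summable_one assms] by simp
  have "(\<lambda>L. \<Sum>j\<le>L. (a_coeff M L j (x / real L))\<^sup>2) \<longlonglongrightarrow> (\<Sum>j. (A_coeff M j x)\<^sup>2)"
    using weighted_tendsto[of "\<lambda>_. 1", OF _ summable_one assms] by simp
  moreover have "(\<lambda>L. a_coeff M (2 * L) 0 (2 * x / real (2 * L))) \<longlonglongrightarrow> A_coeff M 0 (2 * x)"
    using LIMSEQ_subseq_LIMSEQ[OF a_coeff_tendsto[of "2 * x" 0], of "\<lambda>L. 2 * L"] assms
    by (simp add: strict_mono_def o_def)
  ultimately have "(\<Sum>j. (A_coeff M j x)\<^sup>2) = A_coeff M 0 (2 * x)"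
    by (simp add: sum_a_coeff_squared LIMSEQ_unique)
  thus ?thesis using summable_sums[OF s] by simp
qed

lemma A_coeff_0_ge_1: "0 \<le> x \<Longrightarrow> 1 \<le> A_coeff M 0 x"
  using a_coeff_le_A_coeff[of x 0 0] by (simp add: a_coeff_0)

definition log_sum :: "real \<Rightarrow> real" where
  "log_sum x = (\<Sum>j. log 2 (2 * real j + 1) * (A_coeff M j x)\<^sup>2)"

lemma p_weight_eq: "0 \<le> x \<Longrightarrow> p_weight M j x = (A_coeff M j x)\<^sup>2 / A_coeff M 0 (2 * x)"
  unfolding p_weight_def using sums_A_coeff_squared[THEN sums_unique] by simp

lemma F_sums:
  assumes "0 \<le> x"
  shows "(\<lambda>j. p_weight M j x * log 2 (2 * real j + 1)) sums (log_sum x / A_coeff M 0 (2 * x))"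
  using sums_divide[OF summable_sums[OF weighted_summable[OF log_weight_nonneg summable_log assms]], of "A_coeff M 0 (2 * x)"]
  by (simp add: p_weight_eq[OF assms] log_sum_def mult_ac)

lemma F_fun_eq: "0 \<le> x \<Longrightarrow> F_fun M x = log_sum x / A_coeff M 0 (2 * x)"
  unfolding F_fun_def using F_sums[THEN sums_unique] by simp

text \<open>The bound involves only P, P - p and Q - q, each of which increases with x in the
  application, so it may be evaluated at the right endpoint.\<close>

lemma quotient_diff_le:
  fixes p q P Q :: real
  assumes "0 \<le> p" "p \<le> P" "1 \<le> q" "q \<le> Q"
  shows "\<bar>p / q - P / Q\<bar> \<le> (P - p) + P * (Q - q)"
proof -
  have "p / q - P / Q = P * (Q - q) / (q * Q) - (P - p) / q"
    using assms by (simp add: field_simps)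
  moreover have "0 \<le> (P - p) / q" "(P - p) / q \<le> (P - p)"
    using assms by (auto simp: divide_le_eq mult_left_mono[of 1 q "P - p", simplified])
  moreover have "0 \<le> P * (Q - q) / (q * Q)" using assms by simp
  moreover have "P * (Q - q) / (q * Q) \<le> P * (Q - q)"
  proof -
    have "1 * 1 \<le> q * Q" using assms by (intro mult_mono) auto
    hence "P * (Q - q) * 1 \<le> P * (Q - q) * (q * Q)" using assms by (intro mult_left_mono) auto
    thus ?thesis using assms by (subst divide_le_eq) auto
  qed
  ultimately show ?thesis by linarith
qed

lemma uniform_limit_Y:
  assumes "0 \<le> X"
  shows "uniform_limit {0..X} (\<lambda>L x. Y_fun M L (x / real L)) (F_fun M) sequentially"
proof (rule uniform_limitI)
  fix e :: real assume "e > 0"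
  let ?w = "\<lambda>j. log 2 (2 * real j + 1)"
  define N where "N L x = (\<Sum>j\<le>L. ?w j * (a_coeff M L j (x / real L))\<^sup>2)" for L x
  define D where "D L x = (\<Sum>j\<le>L. 1 * (a_coeff M L j (x / real L))\<^sup>2)" for L x
  have "(\<lambda>L. (log_sum X - N L X) + log_sum X * ((\<Sum>j. 1 * (A_coeff M j X)\<^sup>2) - D L X)) \<longlonglongrightarrow>
      (log_sum X - log_sum X) + log_sum X * ((\<Sum>j. 1 * (A_coeff M j X)\<^sup>2) - (\<Sum>j. 1 * (A_coeff M j X)\<^sup>2))"
    unfolding N_def D_def
    by (intro tendsto_intros weighted_tendsto[of ?w, OF log_weight_nonneg summable_log assms, folded log_sum_def]
        weighted_tendsto[of "\<lambda>_. 1", OF _ summable_one assms]) simp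
  hence "\<forall>\<^sub>F L in sequentially. (log_sum X - N L X) + log_sum X * ((\<Sum>j. 1 * (A_coeff M j X)\<^sup>2) - D L X) < e"
    using \<open>e > 0\<close> by (intro order_tendstoD) auto
  thus "\<forall>\<^sub>F L in sequentially. \<forall>x\<in>{0..X}. dist (Y_fun M L (x / real L)) (F_fun M x) < e"
  proof (eventually_elim, intro ballI)
    fix L x
    assume less: "(log_sum X - N L X) + log_sum X * ((\<Sum>j. 1 * (A_coeff M j X)\<^sup>2) - D L X) < e" and "x \<in> {0..X}"
    hence x: "0 \<le> x" "x \<le> X" by auto
    have D: "(\<Sum>j. 1 * (A_coeff M j x)\<^sup>2) = A_coeff M 0 (2 * x)"
      using sums_unique[OF sums_A_coeff_squared[OF x(1)]] by simp
    note n = weighted_error[of ?w, OF log_weight_nonneg summable_log x, of L, folded log_sum_def N_def]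
    note d = weighted_error[of "\<lambda>_. 1", OF zero_le_one summable_one x, of L, folded D_def, unfolded D]
    have "D L x = a_coeff M (2 * L) 0 (x / real L)" by (simp add: D_def sum_a_coeff_squared)
    hence "1 \<le> D L x" using x(1) by (simp add: a_coeff_0_ge_1)
    have "0 \<le> N L x" unfolding N_def by (intro sum_nonneg mult_nonneg_nonneg log_weight_nonneg) auto
    have "log_sum x \<le> log_sum X"
      unfolding log_sum_def
      by (intro suminf_le mult_left_mono power_mono A_coeff_mono A_coeff_nonneg log_weight_nonneg
          weighted_summable summable_log) (use x assms in auto)
    have "Y_fun M L (x / real L) = N L x / D L x"
      by (simp add: Y_fun_def N_def D_def mult.commute)
    hence "dist (Y_fun M L (x / real L)) (F_fun M x) \<le> (log_sum x - N L x) + log_sum x * (A_coeff M 0 (2 * x) - D L x)"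
      unfolding dist_real_def F_fun_eq[OF x(1)]
      using quotient_diff_le[of "N L x" "log_sum x" "D L x" "A_coeff M 0 (2 * x)"] \<open>0 \<le> N L x\<close> \<open>1 \<le> D L x\<close> n(1) d(1)
      by simp
    also have "\<dots> \<le> (log_sum X - N L X) + log_sum X * ((\<Sum>j. 1 * (A_coeff M j X)\<^sup>2) - D L X)"
      using n d \<open>log_sum x \<le> log_sum X\<close> \<open>0 \<le> N L x\<close> by (intro add_mono mult_mono) auto
    finally show "dist (Y_fun M L (x / real L)) (F_fun M x) < e" using less by simp
  qed
qed

subsection \<open>Small arguments\<close>

text \<open>Comparison with the tail of exp 3, uniform in j. Taking k = j gives A_j(x) = O(x^j), as
  the first j coefficients vanish.\<close>

lemma A_coeff_remainder:
  assumes "0 \<le> x" "x \<le> 1"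
  shows "0 \<le> A_coeff M j x - (\<Sum>n<k. real (adj_mult n j) * (x ^ n / fact n))"
    and "A_coeff M j x - (\<Sum>n<k. real (adj_mult n j) * (x ^ n / fact n)) \<le> exp 3 * x ^ k"
proof -
  let ?f = "\<lambda>n. real (adj_mult n j) * (x ^ n / fact n)" and ?g = "\<lambda>n. (3::real) ^ n / fact n"
  have f: "(\<lambda>n. ?f (n + k)) sums (A_coeff M j x - (\<Sum>n<k. ?f n))"
    by (rule sums_split_initial_segment[OF A_coeff_sums])
  show "0 \<le> A_coeff M j x - (\<Sum>n<k. ?f n)"
    by (rule sums_le[OF _ sums_zero f]) (use assms in auto)
  have "?g sums exp 3"
    using exp_converges[of "3::real"] by (simp add: field_simps)
  from sums_mult[OF sums_split_initial_segment[OF this, of k], of "x ^ k"]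
  have g: "(\<lambda>n. x ^ k * ?g (n + k)) sums (x ^ k * (exp 3 - (\<Sum>n<k. ?g n)))" .
  have "A_coeff M j x - (\<Sum>n<k. ?f n) \<le> x ^ k * (exp 3 - (\<Sum>n<k. ?g n))"
  proof (rule sums_le[OF _ f g])
    fix n
    have "real (adj_mult (n + k) j) \<le> 3 ^ (n + k)"
      using adj_mult_le[of "n + k" j] by (metis of_nat_le_iff of_nat_numeral of_nat_power)
    moreover have "x ^ (n + k) \<le> x ^ k" using assms by (intro power_decreasing) auto
    ultimately have "real (adj_mult (n + k) j) * x ^ (n + k) \<le> 3 ^ (n + k) * x ^ k"
      using assms by (intro mult_mono) auto
    thus "?f (n + k) \<le> x ^ k * ?g (n + k)"
      by (simp add: divide_right_mono mult.commute)
  qed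
  also have "\<dots> \<le> x ^ k * exp 3"
    using assms by (intro mult_left_mono) (auto intro!: sum_nonneg)
  finally show "A_coeff M j x - (\<Sum>n<k. ?f n) \<le> exp 3 * x ^ k" by (simp add: mult.commute)
qed

text \<open>The weight of j = 0 is log 1 = 0, A_1(x) is x + O(x^2), the terms from j = 2 on are
  O(x^4), and the denominator A_0(2x) is 1 + O(x^2).\<close>

lemma F_fun_small: "(\<lambda>x. F_fun M x - x\<^sup>2 * log 2 3) \<in> O[at_right 0](\<lambda>x. x ^ 3)"
proof -
  let ?w = "\<lambda>j. log 2 (2 * real j + 1)"
  define S where "S = (\<Sum>j. ?w j / 4 ^ j)"
  define w where "w = log 2 (3::real)"
  define e where "e = exp (3::real)"
  have pos: "w \<ge> 0" "e \<ge> 0" "S \<ge> 0"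
    unfolding w_def e_def S_def by (auto intro!: suminf_nonneg summable_log)
  \<comment> \<open>The three parts of the constant come from squaring A_1 = x + r, from the tail T,
    and from the denominator 1 + s.\<close>
  show ?thesis
  proof (rule bigoI[where c = "(2 * e + e\<^sup>2) * w + 16 * e\<^sup>2 * S + 4 * e * w"])
    \<comment> \<open>Below 1/2 the remainder bound also applies at 2 x, and x^(2j) is at most
      4^(-j), which reproduces the weights of S; the index shift by 2 costs the factor 16.\<close>
    have "\<forall>\<^sub>F x in at_right 0. x \<in> {0<..<1/2::real}"
      by (rule eventually_at_right_real) simp
    thus "\<forall>\<^sub>F x in at_right 0. norm (F_fun M x - x\<^sup>2 * log 2 3) \<le>
        ((2 * e + e\<^sup>2) * w + 16 * e\<^sup>2 * S + 4 * e * w) * norm (x ^ 3)"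
    proof eventually_elim
      fix x :: real assume "x \<in> {0<..<1/2}"
      hence x: "0 < x" "x < 1 / 2" by auto
      define r where "r = A_coeff M 1 x - x"
      define s where "s = A_coeff M 0 (2 * x) - 1"
      define T where "T = (\<Sum>j. ?w (j + 2) * (A_coeff M (j + 2) x)\<^sup>2)"
      have r: "0 \<le> r" "r \<le> e * x\<^sup>2"
        using A_coeff_remainder[of x 1 2] x by (auto simp: r_def e_def eval_nat_numeral)
      have s: "0 \<le> s" "s \<le> 4 * e * x\<^sup>2"
        using A_coeff_remainder[of "2 * x" 0 2] x by (auto simp: s_def e_def eval_nat_numeral)
      have ws: "summable (\<lambda>j. ?w j * (A_coeff M j x)\<^sup>2)"
        using x by (intro weighted_summable log_weight_nonneg summable_log) auto
      have "log_sum x = T + (\<Sum>j<2. ?w j * (A_coeff M j x)\<^sup>2)"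
        unfolding log_sum_def T_def by (rule suminf_split_initial_segment[OF ws])
      hence N: "log_sum x = T + w * (x + r)\<^sup>2"
        by (simp add: eval_nat_numeral w_def r_def)
      have "0 \<le> T"
        unfolding T_def by (intro suminf_nonneg mult_nonneg_nonneg log_weight_nonneg summable_ignore_initial_segment[OF ws, of 2]) auto
      have "T \<le> (\<Sum>j. 16 * e\<^sup>2 * x ^ 4 * (?w (j + 2) / 4 ^ (j + 2)))"
        unfolding T_def
      proof (rule suminf_le)
        show "summable (\<lambda>j. 16 * e\<^sup>2 * x ^ 4 * (?w (j + 2) / 4 ^ (j + 2)))"
          by (intro summable_mult summable_ignore_initial_segment[OF summable_log, of 2])
        show "summable (\<lambda>j. ?w (j + 2) * (A_coeff M (j + 2) x)\<^sup>2)"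
          by (rule summable_ignore_initial_segment[OF ws])
        fix j
        have "A_coeff M (j + 2) x \<le> e * x ^ (j + 2)"
          using A_coeff_remainder(2)[of x "j + 2" "j + 2"] x by (simp add: adj_mult_eq_0 e_def)
        hence "(A_coeff M (j + 2) x)\<^sup>2 \<le> (e * x ^ (j + 2))\<^sup>2"
          using x by (intro power_mono A_coeff_nonneg) auto
        also have "\<dots> = e\<^sup>2 * x ^ 4 * (x\<^sup>2) ^ j"
          by (simp add: power_mult_distrib power_add power_mult[symmetric] mult.commute)
        also have "\<dots> \<le> e\<^sup>2 * x ^ 4 * ((1 / 2)\<^sup>2) ^ j"
          using x by (intro mult_left_mono power_mono) auto
        also have "\<dots> = 16 * e\<^sup>2 * x ^ 4 / 4 ^ (j + 2)" by (simp add: power_divide)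
        finally have "?w (j + 2) * (A_coeff M (j + 2) x)\<^sup>2 \<le> ?w (j + 2) * (16 * e\<^sup>2 * x ^ 4 / 4 ^ (j + 2))"
          by (intro mult_left_mono log_weight_nonneg)
        thus "?w (j + 2) * (A_coeff M (j + 2) x)\<^sup>2 \<le> 16 * e\<^sup>2 * x ^ 4 * (?w (j + 2) / 4 ^ (j + 2))"
          by (simp add: mult_ac)
      qed
      also have "\<dots> = 16 * e\<^sup>2 * x ^ 4 * (\<Sum>j. ?w (j + 2) / 4 ^ (j + 2))"
        by (rule suminf_mult[OF summable_ignore_initial_segment[OF summable_log, of 2]])
      also have "\<dots> \<le> 16 * e\<^sup>2 * x ^ 4 * S"
      proof (rule mult_left_mono)
        have "S = (\<Sum>j. ?w (j + 2) / 4 ^ (j + 2)) + (\<Sum>j<2. ?w j / 4 ^ j)"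
          unfolding S_def by (rule suminf_split_initial_segment[OF summable_log])
        moreover have "0 \<le> (\<Sum>j<2. ?w j / 4 ^ j)"
          by (intro sum_nonneg divide_nonneg_nonneg log_weight_nonneg) auto
        ultimately show "(\<Sum>j. ?w (j + 2) / 4 ^ (j + 2)) \<le> S" by linarith
      qed (use x in auto)
      finally have T: "T \<le> 16 * e\<^sup>2 * S * x ^ 4" by (simp add: mult_ac)
      have x4: "x ^ 4 \<le> x ^ 3" using x by (intro power_decreasing) auto
      have num: "\<bar>log_sum x - x\<^sup>2 * w * (1 + s)\<bar> \<le> ((2 * e + e\<^sup>2) * w + 16 * e\<^sup>2 * S + 4 * e * w) * x ^ 3"
      proof -
        have "log_sum x - x\<^sup>2 * w * (1 + s) = T + w * (2 * x * r + r\<^sup>2) - x\<^sup>2 * w * s"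
          by (simp add: N power2_eq_square algebra_simps)
        moreover have "x * r \<le> e * x ^ 3"
          using r x mult_left_mono[OF r(2), of x] by (simp add: power2_eq_square power3_eq_cube mult_ac)
        moreover have "r\<^sup>2 \<le> e\<^sup>2 * x ^ 3"
        proof -
          have "r\<^sup>2 \<le> (e * x\<^sup>2)\<^sup>2" using r by (intro power_mono)
          also have "\<dots> = e\<^sup>2 * x ^ 4" by (simp add: power_mult_distrib power_mult[symmetric])
          also have "\<dots> \<le> e\<^sup>2 * x ^ 3" by (intro mult_left_mono x4) auto
          finally show ?thesis .
        qed
        ultimately have sq: "log_sum x - x\<^sup>2 * w * (1 + s) = T + w * (2 * x * r + r\<^sup>2) - x\<^sup>2 * w * s"
          and "2 * x * r + r\<^sup>2 \<le> 2 * (e * x ^ 3) + e\<^sup>2 * x ^ 3"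
          by auto
        hence "w * (2 * x * r + r\<^sup>2) \<le> w * (2 * (e * x ^ 3) + e\<^sup>2 * x ^ 3)"
          using pos by (intro mult_left_mono)
        moreover have "16 * e\<^sup>2 * S * x ^ 4 \<le> 16 * e\<^sup>2 * S * x ^ 3"
          using pos x4 by (intro mult_left_mono) auto
        moreover have "0 \<le> x\<^sup>2 * w * s" using pos s by simp
        ultimately have up: "log_sum x - x\<^sup>2 * w * (1 + s) \<le>
            16 * e\<^sup>2 * S * x ^ 3 + w * (2 * (e * x ^ 3) + e\<^sup>2 * x ^ 3)"
          using T sq by linarith
        have lo: "- (4 * e * w * x ^ 3) \<le> log_sum x - x\<^sup>2 * w * (1 + s)"
        proof -
          have "x\<^sup>2 * w * s \<le> x\<^sup>2 * w * (4 * e * x\<^sup>2)" using s pos by (intro mult_left_mono) auto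
          also have "\<dots> = 4 * e * w * x ^ 4" by (simp add: eval_nat_numeral)
          also have "\<dots> \<le> 4 * e * w * x ^ 3" using pos by (intro mult_left_mono x4) auto
          finally have "x\<^sup>2 * w * s \<le> 4 * e * w * x ^ 3" .
          moreover have "0 \<le> w * (2 * x * r + r\<^sup>2)" using pos r x by (intro mult_nonneg_nonneg add_nonneg_nonneg) auto
          ultimately show ?thesis
            using \<open>0 \<le> T\<close> sq by linarith
        qed
        have "((2 * e + e\<^sup>2) * w + 16 * e\<^sup>2 * S + 4 * e * w) * x ^ 3 =
            (16 * e\<^sup>2 * S * x ^ 3 + w * (2 * (e * x ^ 3) + e\<^sup>2 * x ^ 3)) + 4 * e * w * x ^ 3"
          by (simp add: algebra_simps)
        moreover have "0 \<le> 16 * e\<^sup>2 * S * x ^ 3" "0 \<le> w * (2 * (e * x ^ 3) + e\<^sup>2 * x ^ 3)" "0 \<le> 4 * e * w * x ^ 3"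
          using pos x by auto
        ultimately show ?thesis using up lo by linarith
      qed
      have "F_fun M x - x\<^sup>2 * log 2 3 = (log_sum x - x\<^sup>2 * w * (1 + s)) / (1 + s)"
        using x s by (simp add: F_fun_eq s_def w_def diff_divide_distrib)
      hence "\<bar>F_fun M x - x\<^sup>2 * log 2 3\<bar> \<le> \<bar>log_sum x - x\<^sup>2 * w * (1 + s)\<bar>"
        using s by (simp add: divide_le_eq mult_le_cancel_left1)
      thus "norm (F_fun M x - x\<^sup>2 * log 2 3) \<le> ((2 * e + e\<^sup>2) * w + 16 * e\<^sup>2 * S + 4 * e * w) * norm (x ^ 3)"
        using num x by simp
    qed
  qed
qed

end

subsection \<open>Integrals over the line\<close>

lemma integrable_Cauchy: "integrable lborel (\<lambda>x::real. 1 / (1 + x\<^sup>2))"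
  and integral_Cauchy: "(LINT x|lborel. 1 / (1 + x\<^sup>2 :: real)) = pi"
  using integrable_inverse_1_plus_square LBINT_inverse_1_plus_square
  by (simp_all add: set_integrable_def interval_lebesgue_integral_def set_lebesgue_integral_def inverse_eq_divide)

text \<open>The quadratic Taylor term (s / 4)^2 / 2 is s^2 / 32, whence 32. All oscillatory
  integrals below share the resulting Cauchy majorant.\<close>

lemma exp_quarter_le:
  fixes s :: real
  assumes "0 \<le> s"
  shows "exp (- (s / 4)) * (1 + s) \<le> 32 * (1 / (1 + s))"
proof -
  have "1 + s / 4 + (s / 4)\<^sup>2 / 2 \<le> exp (s / 4)"
    using assms exp_lower_Taylor_quadratic[of "s / 4"] by simp
  hence "32 * (1 + s / 4 + (s / 4)\<^sup>2 / 2) \<le> 32 * exp (s / 4)"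
    by (rule mult_left_mono) simp
  moreover have "(1 + s) * (1 + s) \<le> 32 * (1 + s / 4 + (s / 4)\<^sup>2 / 2)"
    using assms by (simp add: power2_eq_square algebra_simps)
  ultimately have "(1 + s) * (1 + s) \<le> 32 * exp (s / 4)" by (rule order_trans[rotated])
  thus ?thesis using assms by (simp add: exp_minus field_simps)
qed

lemma integrable_Cauchy_bound:
  fixes f :: "real \<Rightarrow> real"
  assumes "f \<in> borel_measurable lborel" "\<And>x. \<bar>f x\<bar> \<le> c * (1 / (1 + x\<^sup>2))"
  shows "integrable lborel f" "\<bar>LINT x|lborel. f x\<bar> \<le> c * pi"
proof -
  have i: "integrable lborel (\<lambda>x::real. c * (1 / (1 + x\<^sup>2)))"
    by (intro integrable_mult_right integrable_Cauchy)
  show f: "integrable lborel f"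
    by (rule Bochner_Integration.integrable_bound[OF i assms(1)], rule AE_I2, unfold real_norm_def)
      (rule order_trans[OF assms(2) abs_ge_self])
  have "\<bar>LINT x|lborel. f x\<bar> \<le> (LINT x|lborel. \<bar>f x\<bar>)"
    using integral_norm_bound[of lborel f] by simp
  also have "\<dots> \<le> (LINT x|lborel. c * (1 / (1 + x\<^sup>2)))"
    by (intro integral_mono integrable_abs f i assms)
  also have "\<dots> = c * pi" by (simp only: integral_mult_right_zero integral_Cauchy)
  finally show "\<bar>LINT x|lborel. f x\<bar> \<le> c * pi" .
qed

lemma exp_minus_sq_le: "exp (- (x\<^sup>2)) * (1 + x\<^sup>2) \<le> 32 * (1 / (1 + x\<^sup>2 :: real))"
proof -
  have "exp (- (x\<^sup>2)) * (1 + x\<^sup>2) \<le> exp (- (x\<^sup>2 / 4)) * (1 + x\<^sup>2)"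
    by (intro mult_right_mono) auto
  also have "\<dots> \<le> 32 * (1 / (1 + x\<^sup>2))" by (rule exp_quarter_le) simp
  finally show ?thesis .
qed

lemma abs_le_one_plus_sq: "\<bar>x\<bar> \<le> 1 + x\<^sup>2" for x :: real
  using sum_squares_bound[of "\<bar>x\<bar>" 1] by (auto simp: power2_eq_square)

text \<open>The characteristic function of the standard normal law, with both variables rescaled by
  sqrt 2.\<close>

lemma gaussian_cos: "(LINT s|lborel. exp (- (s\<^sup>2)) * cos (v * s)) = sqrt pi * exp (- (v\<^sup>2) / 4)"
proof -
  define t where "t = v / sqrt 2"
  have "complex_of_real (exp (- (t\<^sup>2) / 2)) = (CLINT x|std_normal_distribution. iexp (t * x))"
    using fun_cong[OF char_std_normal_distribution, of t] by (simp add: char_def)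
  hence "exp (- (t\<^sup>2) / 2) = Re (CLINT x|std_normal_distribution. iexp (t * x))"
    by (metis Re_complex_of_real)
  also have "\<dots> = (LINT x|std_normal_distribution. Re (iexp (t * x)))"
  proof (rule integral_Re[symmetric])
    interpret std_normal: prob_space std_normal_distribution
      by (rule prob_space_normal_density) simp
    show "complex_integrable std_normal_distribution (\<lambda>x. iexp (t * x))"
      by (rule std_normal.integrable_const_bound[where B = 1]) auto
  qed
  also have "\<dots> = (LINT x|lborel. std_normal_density x * cos (t * x))"
    by (subst integral_density) (auto simp: normal_density_nonneg Re_exp)
  also have "\<dots> = \<bar>sqrt 2\<bar> * (LINT x|lborel. std_normal_density (0 + sqrt 2 * x) * cos (t * (0 + sqrt 2 * x)))"
    using lborel_integral_real_affine[of "sqrt 2" "\<lambda>x. std_normal_density x * cos (t * x)" 0] by simp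
  also have "(\<lambda>x. std_normal_density (0 + sqrt 2 * x) * cos (t * (0 + sqrt 2 * x))) =
      (\<lambda>x. 1 / sqrt (2 * pi) * (exp (- (x\<^sup>2)) * cos (v * x)))"
    by (simp add: fun_eq_iff std_normal_density_def t_def power_mult_distrib)
  also have "(LINT x|lborel. 1 / sqrt (2 * pi) * (exp (- (x\<^sup>2)) * cos (v * x))) =
      1 / sqrt (2 * pi) * (LINT x|lborel. exp (- (x\<^sup>2)) * cos (v * x))"
    by (rule integral_mult_right_zero)
  finally have "exp (- (t\<^sup>2) / 2) = (LINT x|lborel. exp (- (x\<^sup>2)) * cos (v * x)) / sqrt pi"
    by (simp add: real_sqrt_mult)
  thus ?thesis by (simp add: t_def power_divide field_simps)
qed

text \<open>The derivative of exp (- s^2) sin (v s) integrates to zero over the line, which reduces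
  the claim to \<open>gaussian_cos\<close>.\<close>

lemma gaussian_sin: "(LINT s|lborel. exp (- (s\<^sup>2)) * s * sin (v * s)) = v / 2 * (sqrt pi * exp (- (v\<^sup>2) / 4))"
proof -
  let ?F = "\<lambda>s. exp (- (s\<^sup>2)) * sin (v * s)"
  let ?f = "\<lambda>s. v * (exp (- (s\<^sup>2)) * cos (v * s)) - 2 * (exp (- (s\<^sup>2)) * s * sin (v * s))"
  have i1: "integrable lborel (\<lambda>s. exp (- (s\<^sup>2)) * cos (v * s))"
  proof (rule integrable_Cauchy_bound)
    fix s :: real
    have "exp (- (s\<^sup>2)) * \<bar>cos (v * s)\<bar> \<le> exp (- (s\<^sup>2)) * (1 + s\<^sup>2)"
      using abs_cos_le_one[of "v * s"] by (intro mult_left_mono) (auto intro: order_trans[of _ 1])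
    thus "\<bar>exp (- (s\<^sup>2)) * cos (v * s)\<bar> \<le> 32 * (1 / (1 + s\<^sup>2))"
      using order_trans[OF _ exp_minus_sq_le[of s]] by (simp add: abs_mult)
  qed measurable
  have i2: "integrable lborel (\<lambda>s. exp (- (s\<^sup>2)) * s * sin (v * s))"
  proof (rule integrable_Cauchy_bound)
    fix s :: real
    have "\<bar>s\<bar> * \<bar>sin (v * s)\<bar> \<le> (1 + s\<^sup>2) * 1"
      using abs_sin_le_one[of "v * s"] abs_le_one_plus_sq[of s] by (intro mult_mono) auto
    hence "exp (- (s\<^sup>2)) * (\<bar>s\<bar> * \<bar>sin (v * s)\<bar>) \<le> exp (- (s\<^sup>2)) * (1 + s\<^sup>2)"
      by (intro mult_left_mono) auto
    thus "\<bar>exp (- (s\<^sup>2)) * s * sin (v * s)\<bar> \<le> 32 * (1 / (1 + s\<^sup>2))"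
      using order_trans[OF _ exp_minus_sq_le[of s]] by (simp add: abs_mult mult.assoc)
  qed measurable
  have lim: "(?F \<longlongrightarrow> 0) F" if "((\<lambda>s::real. exp (- (s\<^sup>2))) \<longlongrightarrow> 0) F" for F
  proof (rule Lim_null_comparison[OF always_eventually that], intro allI)
    fix s show "norm (?F s) \<le> exp (- (s\<^sup>2))"
      using abs_sin_le_one[of "v * s"] by (simp add: abs_mult mult_left_le)
  qed
  have "(LBINT s=-\<infinity>..\<infinity>. ?f s) = 0 - 0"
  proof (rule interval_integral_FTC_integrable)
    show "(?F has_vector_derivative ?f s) (at s)" for s
      unfolding has_real_derivative_iff_has_vector_derivative[symmetric]
      by (auto intro!: derivative_eq_intros simp: algebra_simps)
    show "isCont ?f s" for s by (intro continuous_intros)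
    show "set_integrable lborel (einterval (-\<infinity>) \<infinity>) ?f"
      using i1 i2 by (simp add: set_integrable_def)
    have "((\<lambda>s::real. exp (- (s\<^sup>2))) \<longlongrightarrow> 0) at_bot" by real_asymp
    thus "((?F \<circ> real_of_ereal) \<longlongrightarrow> 0) (at_right (-\<infinity>))"
      unfolding ereal_tendsto_simps1 by (rule lim)
    have "((\<lambda>s::real. exp (- (s\<^sup>2))) \<longlongrightarrow> 0) at_top" by real_asymp
    thus "((?F \<circ> real_of_ereal) \<longlongrightarrow> 0) (at_left \<infinity>)"
      unfolding ereal_tendsto_simps1 by (rule lim)
  qed simp
  hence "(LINT s|lborel. ?f s) = 0"
    by (simp add: interval_lebesgue_integral_def set_lebesgue_integral_def)
  thus ?thesis
    using i1 i2 by (simp add: gaussian_cos)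
qed

subsection \<open>Local limit for differences of Bessel functions\<close>

text \<open>From 1 - cos t = 2 sin^2 (t / 2) and sin y at least y / 2 on [0, pi / 2].\<close>

lemma one_minus_cos_ge:
  fixes t :: real
  assumes "\<bar>t\<bar> \<le> pi"
  shows "t\<^sup>2 / 8 \<le> 1 - cos t"
proof -
  have pos: "y / 2 \<le> sin y" if "0 \<le> y" "y \<le> pi / 2" for y
  proof (cases "y = 0")
    case False
    \<comment> \<open>Half angle: sin y = 2 sin z cos z is at least 2 z cos^2 z by z <= tan z, and
      cos^2 z is at least 1/2 because cos y is nonnegative.\<close>
    define z where "z = y / 2"
    have z: "0 < z" "z \<le> pi / 4" "z < pi / 2" using that False pi_gt_zero unfolding z_def by linarith+
    have c: "0 < cos z" using z by (intro cos_gt_zero_pi) auto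
    have "z \<le> tan z"
      using arctan_le_self[of "tan z"] z tan_gt_zero[of z] by (simp add: arctan_tan)
    hence "z * cos z \<le> sin z" using c by (simp add: tan_def field_simps)
    have "1 / 2 \<le> (cos z)\<^sup>2"
    proof -
      have "0 \<le> cos y" using that pi_gt_zero by (intro cos_ge_zero) linarith+
      moreover have "cos y = 2 * (cos z)\<^sup>2 - 1" using cos_double_cos[of z] by (simp add: z_def)
      ultimately show ?thesis by linarith
    qed
    hence "z * (1 / 2) \<le> z * (cos z)\<^sup>2" using z by (intro mult_left_mono) auto
    moreover have "z * (cos z)\<^sup>2 = z * cos z * cos z" by (simp add: power2_eq_square)
    moreover have "z * cos z * cos z \<le> sin z * cos z"
      using c \<open>z * cos z \<le> sin z\<close> by (intro mult_right_mono) auto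
    moreover have "sin y = 2 * (sin z * cos z)" using sin_double[of z] by (simp add: z_def)
    moreover have "y = 2 * z" by (simp add: z_def)
    ultimately show ?thesis by linarith
  qed simp
  have "(\<bar>t / 2\<bar> / 2)\<^sup>2 \<le> (sin \<bar>t / 2\<bar>)\<^sup>2"
    using assms by (intro power_mono pos) auto
  also have "(sin \<bar>t / 2\<bar>)\<^sup>2 = (sin (t / 2))\<^sup>2" by (cases "0 \<le> t") auto
  finally show ?thesis
    using cos_double_sin[of "t / 2"] by (simp add: power_divide)
qed

text \<open>I_j(2x) has size exp (2 x) / sqrt x for j of order sqrt x; differencing in j costs
  another sqrt x, hence the factor x.\<close>

definition scaled_bessel_diff :: "real \<Rightarrow> nat \<Rightarrow> real" where
  "scaled_bessel_diff x j = x * exp (- (2 * x)) * bessel_diff j (2 * x)"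

lemma scaled_bessel_diff_circle:
  "scaled_bessel_diff x j = x / pi *
     (LINT t|circle_measure. exp (- (2 * x * (1 - cos t))) * sin (t / 2) * sin ((real j + 1 / 2) * t))"
proof -
  have "(cos (real j * t) - cos (real (Suc j) * t)) * exp (x * (2 * cos t)) =
      (2 * exp (2 * x)) * (exp (- (2 * x * (1 - cos t))) * sin (t / 2) * sin ((real j + 1 / 2) * t))" for t
  proof -
    have "exp (x * (2 * cos t)) = exp (2 * x) * exp (- (2 * x * (1 - cos t)))"
      by (simp add: exp_add[symmetric] algebra_simps)
    moreover have "cos (real j * t) - cos (real (Suc j) * t) = 2 * sin ((real j + 1 / 2) * t) * sin (t / 2)"
      by (simp add: cos_diff_cos algebra_simps add_divide_distrib)
    ultimately show ?thesis by simp
  qed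
  hence "2 * pi * bessel_diff j (2 * x) = 2 * exp (2 * x) *
      (LINT t|circle_measure. exp (- (2 * x * (1 - cos t))) * sin (t / 2) * sin ((real j + 1 / 2) * t))"
    unfolding bessel_diff_circle[symmetric] by (simp only: integral_mult_right_zero)
  thus ?thesis
    by (simp add: scaled_bessel_diff_def exp_minus field_simps)
qed

text \<open>The circle integrand after t = s / sqrt x. The surviving power sqrt x is attached to the
  sine of the half angle, which then tends to s / 2.\<close>

definition scaled_kernel :: "real \<Rightarrow> nat \<Rightarrow> real \<Rightarrow> real" where
  "scaled_kernel x j s = indicator {-pi..pi} (s / sqrt x) * (exp (- (2 * x * (1 - cos (s / sqrt x)))) *
     (sqrt x * sin (s / sqrt x / 2)) * sin ((real j + 1 / 2) * (s / sqrt x)))"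

lemma scaled_bessel_diff_kernel:
  assumes "0 < x"
  shows "scaled_bessel_diff x j = 1 / pi * (LINT s|lborel. scaled_kernel x j s)"
proof -
  let ?h = "\<lambda>t. exp (- (2 * x * (1 - cos t))) * sin (t / 2) * sin ((real j + 1 / 2) * t)"
  have "(LINT t|circle_measure. ?h t) = (LINT t|lborel. indicator {-pi..pi} t * ?h t)"
    by (simp add: integral_restrict_space)
  also have "\<dots> = \<bar>1 / sqrt x\<bar> *\<^sub>R (LINT s|lborel. indicator {-pi..pi} (0 + 1 / sqrt x * s) * ?h (0 + 1 / sqrt x * s))"
    by (rule lborel_integral_real_affine) (use assms in simp)
  also have "(\<lambda>s. indicator {-pi..pi} (0 + 1 / sqrt x * s) * ?h (0 + 1 / sqrt x * s)) = (\<lambda>s. 1 / sqrt x * scaled_kernel x j s)"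
    using assms by (simp add: fun_eq_iff scaled_kernel_def)
  also have "(LINT s|lborel. 1 / sqrt x * scaled_kernel x j s) = 1 / sqrt x * (LINT s|lborel. scaled_kernel x j s)"
    by (rule integral_mult_right_zero)
  finally have "(LINT t|circle_measure. ?h t) = 1 / x * (LINT s|lborel. scaled_kernel x j s)"
    using assms by (simp add: field_simps)
  thus ?thesis using assms by (simp add: scaled_bessel_diff_circle)
qed

lemma scaled_kernel_bound:
  assumes "0 < x"
  shows "\<bar>scaled_kernel x j s\<bar> \<le> 32 * (1 / (1 + s\<^sup>2))"
proof (cases "s / sqrt x \<in> {-pi..pi}")
  case True
  hence "(s / sqrt x)\<^sup>2 / 8 \<le> 1 - cos (s / sqrt x)"
    by (intro one_minus_cos_ge) auto
  hence "2 * x * ((s / sqrt x)\<^sup>2 / 8) \<le> 2 * x * (1 - cos (s / sqrt x))"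
    using assms by (intro mult_left_mono) auto
  moreover have "2 * x * ((s / sqrt x)\<^sup>2 / 8) = s\<^sup>2 / 4"
    using assms by (simp add: power_divide)
  ultimately have e: "exp (- (2 * x * (1 - cos (s / sqrt x)))) \<le> exp (- (s\<^sup>2 / 4))"
    by simp
  have "\<bar>sqrt x * sin (s / sqrt x / 2)\<bar> \<le> sqrt x * \<bar>s / sqrt x / 2\<bar>"
    using assms abs_sin_x_le_abs_x[of "s / sqrt x / 2"] by (simp only: abs_mult) (intro mult_mono, auto)
  also have "\<dots> = \<bar>s\<bar> / 2" using assms by simp
  also have "\<dots> \<le> 1 + s\<^sup>2" using abs_le_one_plus_sq[of s] by linarith
  finally have q: "\<bar>sqrt x * sin (s / sqrt x / 2)\<bar> \<le> 1 + s\<^sup>2" .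
  have "\<bar>scaled_kernel x j s\<bar> = exp (- (2 * x * (1 - cos (s / sqrt x)))) *
     \<bar>sqrt x * sin (s / sqrt x / 2)\<bar> * \<bar>sin ((real j + 1 / 2) * (s / sqrt x))\<bar>"
    using True by (simp add: scaled_kernel_def abs_mult)
  also have "\<dots> \<le> exp (- (s\<^sup>2 / 4)) * (1 + s\<^sup>2) * 1"
    by (intro mult_mono e q) auto
  also have "\<dots> \<le> 32 * (1 / (1 + s\<^sup>2))" using exp_quarter_le[of "s\<^sup>2"] by simp
  finally show ?thesis .
qed (simp add: scaled_kernel_def add_pos_nonneg)

lemma scaled_kernel_measurable [measurable]: "scaled_kernel x j \<in> borel_measurable borel"
  unfolding scaled_kernel_def[abs_def] by measurable

lemma scaled_bessel_diff_bound: "0 < x \<Longrightarrow> \<bar>scaled_bessel_diff x j\<bar> \<le> 32"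
  using integrable_Cauchy_bound(2)[of "scaled_kernel x j" 32] scaled_kernel_bound[of x j]
  by (simp add: scaled_bessel_diff_kernel abs_mult divide_le_eq)

text \<open>One integration by parts gives the decay in \<open>j\<close>; the boundary terms vanish because
  \<open>(j + 1/2) \<pi>\<close> is a zero of the cosine.\<close>
lemma scaled_bessel_diff_decay:
  assumes "0 < x"
  shows "\<bar>scaled_bessel_diff x j\<bar> \<le> 64 * sqrt x / (2 * real j + 1)"
proof -
  define m where "m = real j + 1 / 2"
  have m: "m > 0" by (simp add: m_def)
  let ?e = "\<lambda>t. exp (- (2 * x * (1 - cos t)))"
  let ?h = "\<lambda>t. ?e t * sin (t / 2)"
  let ?h' = "\<lambda>t. ?e t * (cos (t / 2) / 2 - 2 * x * sin t * sin (t / 2))"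
  have cos0: "cos (m * pi) = 0"
    by (simp add: m_def distrib_right cos_add)
  have "has_bochner_integral lborel (\<lambda>t. (?h' t * cos (m * t) - m * (?h t * sin (m * t))) * indicator {-pi..pi} t)
      (?h pi * cos (m * pi) - ?h (-pi) * cos (m * (-pi)))"
    by (rule has_bochner_integral_FTC_Icc_real)
      (auto intro!: derivative_eq_intros continuous_intros simp: algebra_simps)
  hence "(LINT t|lborel. (?h' t * cos (m * t) - m * (?h t * sin (m * t))) * indicator {-pi..pi} t) = 0"
    by (simp add: has_bochner_integral_iff cos0)
  hence "(LINT t|circle_measure. ?h' t * cos (m * t) - m * (?h t * sin (m * t))) = 0"
    by (simp add: integral_restrict_space mult.commute)
  moreover have "integrable circle_measure (\<lambda>t. ?h' t * cos (m * t))"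
    by (intro integrable_circle continuous_intros) simp_all
  moreover have "integrable circle_measure (\<lambda>t. m * (?h t * sin (m * t)))"
    by (intro integrable_circle continuous_intros) simp_all
  ultimately have "(LINT t|circle_measure. ?h' t * cos (m * t)) = m * (LINT t|circle_measure. ?h t * sin (m * t))"
    by (simp only: Bochner_Integration.integral_diff integral_mult_right_zero)
  hence eq: "m * scaled_bessel_diff x j = x / pi * (LINT t|circle_measure. ?h' t * cos (m * t))"
    by (simp add: scaled_bessel_diff_circle m_def[symmetric])
  \<comment> \<open>In the variable sqrt x * t the Cauchy majorant does not depend on x, so
    rescaling turns the prefactor x into sqrt x.\<close>
  let ?G = "\<lambda>t. indicator {-pi..pi} t * (?h' t * cos (m * t))"
  have G: "\<bar>?G t\<bar> \<le> 32 * (1 / (1 + (sqrt x * t)\<^sup>2))" for t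
  proof (cases "t \<in> {-pi..pi}")
    case True
    have "2 * x * (t\<^sup>2 / 8) \<le> 2 * x * (1 - cos t)"
      using True assms by (intro mult_left_mono one_minus_cos_ge) auto
    hence e: "?e t \<le> exp (- (x * t\<^sup>2 / 4))" by simp
    have "\<bar>2 * x * sin t * sin (t / 2)\<bar> \<le> 2 * x * \<bar>t\<bar> * \<bar>t / 2\<bar>"
      using assms unfolding abs_mult
      by (intro mult_mono abs_sin_x_le_abs_x mult_nonneg_nonneg) auto
    also have "\<dots> = x * t\<^sup>2" by (simp add: power2_eq_square abs_mult_self_eq)
    finally have "\<bar>cos (t / 2) / 2 - 2 * x * sin t * sin (t / 2)\<bar> \<le> 1 + x * t\<^sup>2"
      using abs_cos_le_one[of "t / 2"] by linarith
    hence "?e t * \<bar>cos (t / 2) / 2 - 2 * x * sin t * sin (t / 2)\<bar> * \<bar>cos (m * t)\<bar> \<le> exp (- (x * t\<^sup>2 / 4)) * (1 + x * t\<^sup>2) * 1"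
      by (intro mult_mono e) (use assms in auto)
    also have "\<dots> \<le> 32 * (1 / (1 + x * t\<^sup>2))"
      using exp_quarter_le[of "x * t\<^sup>2"] assms by simp
    finally show ?thesis using True assms by (simp add: abs_mult power_mult_distrib)
  qed (simp add: add_pos_nonneg)
  have "(LINT t|circle_measure. ?h' t * cos (m * t)) = (LINT t|lborel. ?G t)"
    by (simp add: integral_restrict_space)
  also have "\<dots> = \<bar>1 / sqrt x\<bar> *\<^sub>R (LINT s|lborel. ?G (0 + 1 / sqrt x * s))"
    by (rule lborel_integral_real_affine) (use assms in simp)
  finally have "\<bar>LINT t|circle_measure. ?h' t * cos (m * t)\<bar> = 1 / sqrt x * \<bar>LINT s|lborel. ?G (0 + 1 / sqrt x * s)\<bar>"
    using assms by (simp add: abs_mult)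
  also have "\<dots> \<le> 1 / sqrt x * (32 * pi)"
  proof (intro mult_left_mono integrable_Cauchy_bound(2))
    show "(\<lambda>s. ?G (0 + 1 / sqrt x * s)) \<in> borel_measurable lborel" by measurable
    show "\<bar>?G (0 + 1 / sqrt x * s)\<bar> \<le> 32 * (1 / (1 + s\<^sup>2))" for s
      using G[of "0 + 1 / sqrt x * s"] assms by simp
  qed (use assms in simp)
  finally have "x / pi * \<bar>LINT t|circle_measure. ?h' t * cos (m * t)\<bar> \<le> x / pi * (1 / sqrt x * (32 * pi))"
    using assms by (intro mult_left_mono) auto
  also have "\<dots> = 32 * (x / sqrt x)" by simp
  also have "x / sqrt x = sqrt x" using assms by (simp add: real_div_sqrt)
  finally have "m * \<bar>scaled_bessel_diff x j\<bar> \<le> 32 * sqrt x"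
    using arg_cong[OF eq, of abs] m assms by (simp add: abs_mult)
  thus ?thesis using m by (simp add: m_def field_simps)
qed

text \<open>Since 2 x (1 - cos (s / sqrt x)) tends to s^2, the kernel becomes Gaussian. The index
  may vary with x, as it must for a floor; the constant is (1 / pi) (v / 4) sqrt pi.\<close>

lemma scaled_bessel_diff_tendsto:
  assumes J: "((\<lambda>x. (real (J x) + 1 / 2) / sqrt x) \<longlongrightarrow> v) at_top"
  shows "((\<lambda>x. scaled_bessel_diff x (J x)) \<longlongrightarrow> v / (4 * sqrt pi) * exp (- (v\<^sup>2) / 4)) at_top"
proof -
  have "((\<lambda>x. LINT s|lborel. scaled_kernel x (J x) s) \<longlongrightarrow> (LINT s|lborel. exp (- (s\<^sup>2)) * (s / 2) * sin (v * s))) at_top"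
  proof (rule integral_dominated_convergence_at_top)
    show "integrable lborel (\<lambda>s::real. 32 * (1 / (1 + s\<^sup>2)))"
      by (intro integrable_mult_right integrable_Cauchy)
    show "\<forall>\<^sub>F x in at_top. AE s in lborel. norm (scaled_kernel x (J x) s) \<le> 32 * (1 / (1 + s\<^sup>2))"
      using eventually_gt_at_top[of 0]
      by eventually_elim (unfold real_norm_def, intro AE_I2 scaled_kernel_bound)
    show "AE s in lborel. ((\<lambda>x. scaled_kernel x (J x) s) \<longlongrightarrow> exp (- (s\<^sup>2)) * (s / 2) * sin (v * s)) at_top"
    proof (rule AE_I2)
      fix s :: real
      have "((\<lambda>x. indicator {-pi..pi} (s / sqrt x) :: real) \<longlongrightarrow> 1) at_top"
      proof (rule tendsto_eventually)
        have "((\<lambda>x. s / sqrt x) \<longlongrightarrow> 0) at_top" by real_asymp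
        hence "\<forall>\<^sub>F x in at_top. dist (s / sqrt x) 0 < pi" by (rule tendstoD) simp
        thus "\<forall>\<^sub>F x in at_top. (indicator {-pi..pi} (s / sqrt x) :: real) = 1"
        proof eventually_elim
          case (elim x)
          hence "\<bar>s / sqrt x\<bar> < pi" by (simp only: dist_real_def diff_zero)
          hence "s / sqrt x \<in> {-pi..pi}" by (simp only: atLeastAtMost_iff abs_less_iff) linarith
          thus ?case by (rule indicator_simps(1))
        qed
      qed
      moreover have "((\<lambda>x. exp (- (2 * x * (1 - cos (s / sqrt x))))) \<longlongrightarrow> exp (- (s\<^sup>2))) at_top"
        unfolding power2_eq_square by real_asymp
      moreover have "((\<lambda>x. sqrt x * sin (s / sqrt x / 2)) \<longlongrightarrow> s / 2) at_top"
        by real_asymp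
      moreover have "((\<lambda>x. sin ((real (J x) + 1 / 2) / sqrt x * s)) \<longlongrightarrow> sin (v * s)) at_top"
        by (intro tendsto_intros J)
      ultimately have "((\<lambda>x. indicator {-pi..pi} (s / sqrt x) * (exp (- (2 * x * (1 - cos (s / sqrt x)))) *
          (sqrt x * sin (s / sqrt x / 2)) * sin ((real (J x) + 1 / 2) / sqrt x * s))) \<longlongrightarrow>
          1 * (exp (- (s\<^sup>2)) * (s / 2) * sin (v * s))) at_top"
        by (intro tendsto_mult)
      thus "((\<lambda>x. scaled_kernel x (J x) s) \<longlongrightarrow> exp (- (s\<^sup>2)) * (s / 2) * sin (v * s)) at_top"
        by (simp add: scaled_kernel_def)
    qed
  qed measurable
  also have "(LINT s|lborel. exp (- (s\<^sup>2)) * (s / 2) * sin (v * s)) = v / 4 * (sqrt pi * exp (- (v\<^sup>2) / 4))"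
    using gaussian_sin[of v] by simp
  finally have "((\<lambda>x. 1 / pi * (LINT s|lborel. scaled_kernel x (J x) s)) \<longlongrightarrow> 1 / pi * (v / 4 * (sqrt pi * exp (- (v\<^sup>2) / 4)))) at_top"
    by (intro tendsto_intros)
  moreover have "\<forall>\<^sub>F x in at_top. 1 / pi * (LINT s|lborel. scaled_kernel x (J x) s) = scaled_bessel_diff x (J x)"
    using eventually_gt_at_top[of 0] by eventually_elim (simp add: scaled_bessel_diff_kernel)
  moreover have "1 / pi * (v / 4 * (sqrt pi * exp (- (v\<^sup>2) / 4))) = v / (4 * sqrt pi) * exp (- (v\<^sup>2) / 4)"
  proof -
    have "1 / pi * (v / 4 * (sqrt pi * exp (- (v\<^sup>2) / 4))) = v / 4 * exp (- (v\<^sup>2) / 4) * (sqrt pi / pi)"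
      by (simp add: mult_ac)
    also have "sqrt pi / pi = 1 / sqrt pi" by (simp add: sqrt_divide_self_eq inverse_eq_divide)
    finally show ?thesis by simp
  qed
  ultimately show ?thesis by (simp add: tendsto_cong)
qed

subsection \<open>A logarithmic moment\<close>

lemma Gamma_half_line_integral:
  fixes x :: real
  assumes "0 < x"
  shows "((\<lambda>t. t powr (x - 1) / exp t) has_integral Gamma x) {0<..}"
proof -
  let ?f = "\<lambda>t::real. t powr (x - 1) / exp t"
  have "(?f has_integral Gamma x) {0<..} \<longleftrightarrow> (?f has_integral Gamma x) {0..}"
    by (rule has_integral_spike_set_eq; rule negligible_subset[of "{0}"]) auto
  thus ?thesis using Gamma_integral_real[OF assms] by blast
qed

text \<open>Both bounds are 1 + u <= exp u, for u = h ln t and u = - h ln t.\<close>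

lemma powr_difference_quotient_bounds:
  fixes t h :: real
  assumes "0 < t" "0 < h"
  shows "ln t \<le> (t powr h - 1) / h" "(t powr h - 1) / h \<le> t powr h * ln t"
proof -
  have "1 + h * ln t \<le> t powr h"
    using exp_ge_add_one_self[of "h * ln t"] assms by (simp add: powr_def)
  thus "ln t \<le> (t powr h - 1) / h" using assms by (simp add: field_simps)
  have "1 + - (h * ln t) \<le> exp (- (h * ln t))" by (rule exp_ge_add_one_self)
  hence "(1 - h * ln t) * t powr h \<le> exp (- (h * ln t)) * t powr h" by (intro mult_right_mono) auto
  also have "\<dots> = 1" using assms by (simp add: powr_def exp_minus)
  finally show "(t powr h - 1) / h \<le> t powr h * ln t" using assms by (simp add: field_simps)
qed

text \<open>Uniform in h: the square controls t >= 1, and t^(-1/2) controls the logarithm near 0.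
  Times t^(1/2) both become Gamma integrands.\<close>

lemma powr_difference_quotient_abs_le:
  fixes t h :: real
  assumes "0 < t" "0 < h" "h \<le> 1"
  shows "\<bar>(t powr h - 1) / h\<bar> \<le> t powr 2 + 2 * t powr (- (1 / 2))"
proof (cases "1 \<le> t")
  case True
  have "0 \<le> ln t" using True by simp
  have "t powr h * ln t \<le> t powr 1 * t"
    using True assms ln_le_minus_one[of t] by (intro mult_mono powr_mono) auto
  also have "\<dots> = t powr 2" using assms by (simp add: power2_eq_square)
  finally show ?thesis
    using powr_difference_quotient_bounds[OF assms(1,2)] \<open>0 \<le> ln t\<close> powr_ge_zero[of t "- (1 / 2)"] by linarith
next
  case False
  have "ln (t powr (- (1 / 2))) \<le> t powr (- (1 / 2)) - 1"
    using assms by (intro ln_le_minus_one) auto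
  hence "- ln t \<le> 2 * t powr (- (1 / 2))" using assms by (simp add: ln_powr)
  moreover have "t powr h * ln t \<le> 0" using False assms by (intro mult_nonneg_nonpos) auto
  ultimately show ?thesis
    using powr_difference_quotient_bounds[OF assms(1,2)] powr_ge_zero[of t 2] by linarith
qed

text \<open>Differentiation of the Gamma integral at 3/2, done by dominated convergence along steps
  1 / (n + 1); the known derivative of Gamma identifies the limit.\<close>

lemma ln_Gamma_integral:
  "((\<lambda>t::real. t powr (1 / 2) / exp t * ln t) has_integral Gamma (3 / 2) * Digamma (3 / 2)) {0<..}"
  "(\<lambda>t::real. t powr (1 / 2) / exp t * ln t) absolutely_integrable_on {0<..}"
proof -
  define h where "h n = inverse (real (Suc n))" for n
  have h: "0 < h n" "h n \<le> 1" for n by (auto simp: h_def inverse_le_1_iff)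
  have h0: "h \<longlonglongrightarrow> 0" unfolding h_def by (rule LIMSEQ_inverse_real_of_nat)
  let ?f = "\<lambda>n t. (t powr (1 / 2 + h n) / exp t - t powr (1 / 2) / exp t) / h n"
  let ?g = "\<lambda>t::real. t powr (1 / 2) / exp t * ln t"
  let ?d = "\<lambda>t::real. t powr (5 / 2) / exp t + 2 * (t powr 0 / exp t)"
  have f_eq: "?f n t = t powr (1 / 2) / exp t * ((t powr h n - 1) / h n)" if "0 < t" for n t
    unfolding powr_add by (simp add: field_simps)
  have d_eq: "?d t = t powr (1 / 2) / exp t * (t powr 2 + 2 * t powr (- (1 / 2)))" if "0 < t" for t
  proof -
    have a: "t powr (5 / 2) = t powr (1 / 2) * t powr 2" using powr_add[of t "1 / 2" 2] by simp
    have b: "t powr 0 = t powr (1 / 2) * t powr (- (1 / 2))" using powr_add[of t "1 / 2" "- (1 / 2)"] by simp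
    have "P * Q / E + 2 * (P * R / E) = P / E * (Q + 2 * R)" for P Q R E :: real
      by (simp add: algebra_simps)
    thus ?thesis unfolding a b .
  qed
  have int: "(?f n has_integral (Gamma (3 / 2 + h n) - Gamma (3 / 2)) / h n) {0<..}" for n
    using has_integral_divide[OF has_integral_diff[OF Gamma_half_line_integral[of "3 / 2 + h n"] Gamma_half_line_integral[of "3 / 2"]], of "h n"] h[of n]
    by (simp add: add.commute)
  have intd: "?d integrable_on {0<..}"
  proof -
    have a: "((\<lambda>t::real. t powr (5 / 2) / exp t) has_integral Gamma (7 / 2)) {0<..}"
      using Gamma_half_line_integral[of "7 / 2"] by simp
    have b: "((\<lambda>t::real. t powr 0 / exp t) has_integral Gamma 1) {0<..}"
      using Gamma_half_line_integral[of 1] by (simp only: diff_self zero_less_one)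
    show ?thesis
      by (rule has_integral_integrable[OF has_integral_add[OF a has_integral_mult_right[OF b, of 2]]])
  qed
  have bound: "norm (?f n t) \<le> ?d t" if "t \<in> {0<..}" for n t
  proof -
    have "0 < t" using that by simp
    have "\<bar>t powr (1 / 2) / exp t\<bar> * \<bar>(t powr h n - 1) / h n\<bar> \<le> t powr (1 / 2) / exp t * (t powr 2 + 2 * t powr (- (1 / 2)))"
      using \<open>0 < t\<close> h[of n] by (intro mult_mono powr_difference_quotient_abs_le) auto
    thus ?thesis unfolding f_eq[OF \<open>0 < t\<close>] d_eq[OF \<open>0 < t\<close>] real_norm_def abs_mult .
  qed
  have lim: "(\<lambda>n. ?f n t) \<longlonglongrightarrow> ?g t" if "t \<in> {0<..}" for t
  proof -
    have "0 < t" using that by simp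
    have "((\<lambda>z. t powr z) has_real_derivative t powr 0 * ln t) (at 0)"
      using \<open>0 < t\<close> by (auto intro!: derivative_eq_intros)
    hence "((\<lambda>z. (t powr (0 + z) - t powr 0) / z) \<longlongrightarrow> t powr 0 * ln t) (at 0)"
      by (simp only: DERIV_def)
    moreover have "filterlim h (at 0) sequentially"
      using h0 h by (auto simp: filterlim_at order.strict_iff_order intro!: always_eventually)
    ultimately have "(\<lambda>n. (t powr (0 + h n) - t powr 0) / h n) \<longlonglongrightarrow> t powr 0 * ln t"
      by (rule filterlim_compose)
    hence "(\<lambda>n. (t powr h n - 1) / h n) \<longlonglongrightarrow> ln t" using \<open>0 < t\<close> by simp
    thus ?thesis unfolding f_eq[OF \<open>0 < t\<close>] by (intro tendsto_intros)
  qed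
  have "(Gamma has_field_derivative Gamma (3 / 2) * Digamma (3 / 2)) (at (3 / 2 :: real))"
    by (rule has_field_derivative_Gamma) auto
  hence "((\<lambda>z::real. (Gamma (3 / 2 + z) - Gamma (3 / 2)) / z) \<longlongrightarrow> Gamma (3 / 2) * Digamma (3 / 2)) (at 0)"
    by (simp only: DERIV_def)
  moreover have "filterlim h (at 0) sequentially"
    using h0 h by (auto simp: filterlim_at order.strict_iff_order intro!: always_eventually)
  ultimately have y: "(\<lambda>n. (Gamma (3 / 2 + h n) - Gamma (3 / 2)) / h n) \<longlonglongrightarrow> Gamma (3 / 2) * Digamma (3 / 2)"
    by (rule filterlim_compose)
  show g: "(?g has_integral Gamma (3 / 2) * Digamma (3 / 2)) {0<..}"
    by (rule has_integral_dominated_convergence[OF int intd _ _ y]) (use bound lim in auto)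
  show "?g absolutely_integrable_on {0<..}"
  proof (rule absolutely_integrable_integrable_bound[OF _ _ intd])
    show "norm (?g t) \<le> ?d t" if "t \<in> {0<..}" for t
      by (rule LIMSEQ_le_const2[OF tendsto_norm[OF lim[OF that]]]) (use bound[OF that] in auto)
    show "?g integrable_on {0<..}" using g by (auto simp: integrable_on_def)
  qed
qed

lemma half_square_substitution:
  fixes f :: "real \<Rightarrow> real"
  assumes "f absolutely_integrable_on {0<..}" "(f has_integral b) {0<..}"
    and [measurable]: "f \<in> borel_measurable borel"
  shows "set_integrable lborel {0<..} (\<lambda>v. v * f (v\<^sup>2 / 2))" "(LINT v:{0<..}|lborel. v * f (v\<^sup>2 / 2)) = b"
proof -
  let ?g = "\<lambda>v::real. v\<^sup>2 / 2"
  have img: "?g ` {0<..} = {0<..}"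
  proof (intro set_eqI iffI)
    fix t :: real assume "t \<in> {0<..}"
    thus "t \<in> ?g ` {0<..}" by (intro image_eqI[of _ _ "sqrt (2 * t)"]) auto
  qed auto
  have inj: "inj_on ?g {0<..}" by (rule inj_onI) (simp add: power2_eq_iff)
  have "(\<lambda>x. \<bar>x\<bar> * f (?g x)) absolutely_integrable_on {0<..} \<and> integral {0<..} (\<lambda>x. \<bar>x\<bar> * f (?g x)) = b"
  proof (subst has_absolute_integral_change_of_variables_1'[OF _ _ inj])
    show "(?g has_field_derivative x) (at x within {0<..})" for x
      by (auto intro!: derivative_eq_intros)
    show "f absolutely_integrable_on ?g ` {0<..} \<and> integral (?g ` {0<..}) f = b"
      unfolding img using assms integral_unique by blast
  qed simp
  hence "(\<lambda>x. \<bar>x\<bar> * f (?g x)) absolutely_integrable_on {0<..}" and I: "integral {0<..} (\<lambda>x. \<bar>x\<bar> * f (?g x)) = b"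
    by auto
  \<comment> \<open>Absolute integrability refers to completed Lebesgue measure; Borel measurability
    of the integrand allows the return to \<open>lborel\<close>.\<close>
  hence "integrable (completion lborel) (\<lambda>x. indicator {0<..} x *\<^sub>R (\<bar>x\<bar> * f (?g x)))"
    by (simp add: set_integrable_def)
  hence "integrable lborel (\<lambda>x. indicator {0<..} x *\<^sub>R (\<bar>x\<bar> * f (?g x)))"
    by (subst (asm) integrable_completion) auto
  moreover have eq: "(\<lambda>x. indicator {0<..} x *\<^sub>R (\<bar>x\<bar> * f (?g x))) = (\<lambda>x. indicator {0<..} x *\<^sub>R (x * f (?g x)))"
    by (auto simp: fun_eq_iff indicator_def)
  ultimately show S: "set_integrable lborel {0<..} (\<lambda>v. v * f (v\<^sup>2 / 2))"
    by (simp add: set_integrable_def)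
  have "(LINT v:{0<..}|lborel. v * f (v\<^sup>2 / 2)) = integral {0<..} (\<lambda>v. v * f (v\<^sup>2 / 2))"
    by (rule set_borel_integral_eq_integral(2)[OF S])
  also have "\<dots> = integral {0<..} (\<lambda>x. \<bar>x\<bar> * f (?g x))"
    by (rule Henstock_Kurzweil_Integration.integral_cong) auto
  finally show "(LINT v:{0<..}|lborel. v * f (v\<^sup>2 / 2)) = b" using I by simp
qed

lemma half_square_powr: "0 < v \<Longrightarrow> v * ((v\<^sup>2 / 2) powr (1 / 2) / exp (v\<^sup>2 / 2)) = v\<^sup>2 * exp (- (v\<^sup>2) / 2) / sqrt 2"
  for v :: real
  by (simp add: powr_half_sqrt real_sqrt_divide exp_minus power2_eq_square field_simps)

lemma maxwell_integral:
  "set_integrable lborel {0<..} (\<lambda>v::real. v\<^sup>2 * exp (- (v\<^sup>2) / 2))"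
  "(LINT v:{0<..}|lborel. v\<^sup>2 * exp (- (v\<^sup>2) / 2)) = sqrt 2 * Gamma (3 / 2 :: real)"
proof -
  let ?f = "\<lambda>t::real. t powr (1 / 2) / exp t"
  have i: "(?f has_integral Gamma (3 / 2)) {0<..}"
    using Gamma_half_line_integral[of "3 / 2 :: real"] by simp
  have a: "?f absolutely_integrable_on {0<..}"
    by (rule nonnegative_absolutely_integrable_1) (use i in \<open>auto simp: integrable_on_def\<close>)
  have eq: "(\<lambda>v. indicator {0<..} v *\<^sub>R (v\<^sup>2 * exp (- (v\<^sup>2) / 2))) =
      (\<lambda>v. sqrt 2 * (indicator {0<..} v *\<^sub>R (v * ((v\<^sup>2 / 2) powr (1 / 2) / exp (v\<^sup>2 / 2)))))"
  proof
    fix v :: real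
    show "indicator {0<..} v *\<^sub>R (v\<^sup>2 * exp (- (v\<^sup>2) / 2)) =
      sqrt 2 * (indicator {0<..} v *\<^sub>R (v * ((v\<^sup>2 / 2) powr (1 / 2) / exp (v\<^sup>2 / 2))))"
    proof (cases "0 < v")
      case True
      show ?thesis unfolding half_square_powr[OF True] using True by simp
    qed simp
  qed
  show "set_integrable lborel {0<..} (\<lambda>v::real. v\<^sup>2 * exp (- (v\<^sup>2) / 2))"
    unfolding set_integrable_def eq
    by (intro integrable_mult_right half_square_substitution(1)[OF a i, unfolded set_integrable_def]) measurable
  show "(LINT v:{0<..}|lborel. v\<^sup>2 * exp (- (v\<^sup>2) / 2)) = sqrt 2 * Gamma (3 / 2 :: real)"
    unfolding set_lebesgue_integral_def eq integral_mult_right_zero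
    by (subst half_square_substitution(2)[OF a i, unfolded set_lebesgue_integral_def]) auto
qed

text \<open>With t = v^2 / 2 one has ln (2 v) = (ln t) / 2 + (3 / 2) ln 2, which splits the moment
  into the two integrals already known.\<close>

lemma maxwell_log_integral:
  "(LINT v:{0<..}|lborel. v\<^sup>2 * exp (- (v\<^sup>2) / 2) * ln (2 * v)) =
     sqrt 2 * Gamma (3 / 2) * (1 - euler_mascheroni / 2 + ln 2 / 2)"
proof -
  let ?f = "\<lambda>t::real. t powr (1 / 2) / exp t * ln t"
  let ?m = "\<lambda>v::real. v\<^sup>2 * exp (- (v\<^sup>2) / 2)"
  note s = half_square_substitution[OF ln_Gamma_integral(2,1)]
  have m: "?f \<in> borel_measurable borel" by measurable
  have eq: "(\<lambda>v. indicator {0<..} v *\<^sub>R (?m v * ln (2 * v))) =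
      (\<lambda>v. sqrt 2 / 2 * (indicator {0<..} v *\<^sub>R (v * ?f (v\<^sup>2 / 2))) + 3 / 2 * ln 2 * (indicator {0<..} v *\<^sub>R ?m v))"
  proof
    fix v :: real
    show "indicator {0<..} v *\<^sub>R (?m v * ln (2 * v)) =
      sqrt 2 / 2 * (indicator {0<..} v *\<^sub>R (v * ?f (v\<^sup>2 / 2))) + 3 / 2 * ln 2 * (indicator {0<..} v *\<^sub>R ?m v)"
    proof (cases "0 < v")
      case True
      have "v * ?f (v\<^sup>2 / 2) = (v * ((v\<^sup>2 / 2) powr (1 / 2) / exp (v\<^sup>2 / 2))) * ln (v\<^sup>2 / 2)"
        by (simp only: mult.assoc)
      also have "\<dots> = ?m v / sqrt 2 * (2 * ln v - ln 2)"
        unfolding half_square_powr[OF True] using True by (simp add: ln_div ln_realpow)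
      finally have "sqrt 2 / 2 * (v * ?f (v\<^sup>2 / 2)) = ?m v * (ln v - ln 2 / 2)"
        by (simp add: field_simps)
      thus ?thesis using True by (simp add: ln_mult algebra_simps)
    qed (simp add: indicator_def)
  qed
  have i1: "integrable lborel (\<lambda>v. sqrt 2 / 2 * (indicator {0<..} v *\<^sub>R (v * ?f (v\<^sup>2 / 2))))"
    by (intro integrable_mult_right s(1)[unfolded set_integrable_def] m)
  have i2: "integrable lborel (\<lambda>v. 3 / 2 * ln 2 * (indicator {0<..} v *\<^sub>R ?m v))"
    by (intro integrable_mult_right maxwell_integral(1)[unfolded set_integrable_def])
  have "(LINT v:{0<..}|lborel. ?m v * ln (2 * v)) =
      sqrt 2 / 2 * (Gamma (3 / 2) * Digamma (3 / 2)) + 3 / 2 * ln 2 * (sqrt 2 * Gamma (3 / 2))"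
    unfolding set_lebesgue_integral_def eq Bochner_Integration.integral_add[OF i1 i2] integral_mult_right_zero
    by (simp only: s(2)[OF m, unfolded set_lebesgue_integral_def] maxwell_integral(2)[unfolded set_lebesgue_integral_def])
  also have "Digamma (3 / 2 :: real) = 2 - euler_mascheroni - 2 * ln 2"
    using Digamma_half_integer[of 1, where 'a = real] by simp
  finally show ?thesis by (simp add: algebra_simps)
qed

subsection \<open>Riemann sums\<close>

text \<open>Writing the sum as the integral of a step function with cells of length 1 / r replaces
  Riemann sum estimates by dominated convergence in v.\<close>

lemma integral_floor:
  fixes u :: "nat \<Rightarrow> real"
  assumes "0 < r" and int: "set_integrable lborel {0..} (\<lambda>v. u (nat \<lfloor>v * r\<rfloor>))"
  shows "(LINT v:{0..}|lborel. u (nat \<lfloor>v * r\<rfloor>)) = (\<Sum>n. u n / r)"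
proof -
  define A where "A n = {real n / r..<(real n + 1) / r}" for n
  have A: "v \<in> A n \<longleftrightarrow> 0 \<le> v \<and> nat \<lfloor>v * r\<rfloor> = n" for v n
  proof -
    have "v \<in> A n \<longleftrightarrow> real n \<le> v * r \<and> v * r < real n + 1"
      using assms(1) by (simp add: A_def field_simps)
    also have "\<dots> \<longleftrightarrow> \<lfloor>v * r\<rfloor> = int n" by (simp add: floor_eq_iff)
    also have "\<dots> \<longleftrightarrow> 0 \<le> v \<and> nat \<lfloor>v * r\<rfloor> = n"
    proof -
      have "0 \<le> \<lfloor>v * r\<rfloor> \<longleftrightarrow> 0 \<le> v" using assms(1) by (simp add: zero_le_mult_iff)
      moreover have "a = int n \<longleftrightarrow> 0 \<le> a \<and> nat a = n" for a by auto
      ultimately show ?thesis by blast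
    qed
    finally show ?thesis .
  qed
  have U: "{0..} = (\<Union>n. A n)" by (auto simp: A)
  have "(LINT v:{0..}|lborel. u (nat \<lfloor>v * r\<rfloor>)) = (\<Sum>n. LINT v:A n|lborel. u (nat \<lfloor>v * r\<rfloor>))"
    unfolding U
  proof (rule lebesgue_integral_countable_add)
    show "A i \<in> sets lborel" for i by (simp add: A_def)
    show "A i \<inter> A j = {}" if "i \<noteq> j" for i j using that by (auto simp: A)
    show "set_integrable lborel (\<Union>n. A n) (\<lambda>v. u (nat \<lfloor>v * r\<rfloor>))" using int unfolding U .
  qed
  also have "(\<lambda>n. LINT v:A n|lborel. u (nat \<lfloor>v * r\<rfloor>)) = (\<lambda>n. u n / r)"
  proof
    fix n
    have "(LINT v:A n|lborel. u (nat \<lfloor>v * r\<rfloor>)) = (LINT v:A n|lborel. u n)"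
      by (intro set_lebesgue_integral_cong allI impI) (simp add: A_def, simp only: A)
    also have "\<dots> = measure lborel (A n) * u n"
      by (simp add: set_lebesgue_integral_def A_def emeasure_lborel_Ico divide_right_mono assms(1) order.strict_implies_order)
    also have "measure lborel (A n) = 1 / r"
      using assms(1) by (simp add: A_def divide_right_mono add_divide_distrib)
    finally show "(LINT v:A n|lborel. u (nat \<lfloor>v * r\<rfloor>)) = u n / r" by simp
  qed
  finally show ?thesis .
qed

text \<open>Behaves like v^(-1/2) at 0 and v^(-3/2) at infinity; an antiderivative is 2 arctan (sqrt
  v).\<close>

lemma integrable_dominator: "integrable lborel (\<lambda>v::real. indicator {0<..} v * (1 / ((1 + v) * sqrt v)))"
proof -
  have "set_integrable lborel (einterval 0 \<infinity>) (\<lambda>v. 1 / ((1 + v) * sqrt v))"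
  proof (rule interval_integral_FTC_nonneg(1))
    fix v :: real assume v: "0 < ereal v"
    show "((\<lambda>v. 2 * arctan (sqrt v)) has_real_derivative 1 / ((1 + v) * sqrt v)) (at v)"
    proof -
      have "((\<lambda>v. 2 * arctan (sqrt v)) has_real_derivative 2 * (inverse (1 + (sqrt v)\<^sup>2) * (inverse (sqrt v) / 2))) (at v)"
        using v by (auto intro!: derivative_eq_intros)
      thus ?thesis using v by (simp add: inverse_eq_divide)
    qed
    show "isCont (\<lambda>v. 1 / ((1 + v) * sqrt v)) v"
      using v by (intro continuous_intros) auto
  next
    show "AE v in lborel. 0 < ereal v \<longrightarrow> ereal v < \<infinity> \<longrightarrow> 0 \<le> 1 / ((1 + v) * sqrt v)"
      by simp
    have "((\<lambda>v. 2 * arctan (sqrt v)) \<longlongrightarrow> 0) (at_right 0)" by real_asymp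
    thus "(((\<lambda>v. 2 * arctan (sqrt v)) \<circ> real_of_ereal) \<longlongrightarrow> 0) (at_right 0)"
      unfolding zero_ereal_def ereal_tendsto_simps1 .
    have "((\<lambda>v. 2 * arctan (sqrt v)) \<longlongrightarrow> pi) at_top" by real_asymp
    thus "(((\<lambda>v. 2 * arctan (sqrt v)) \<circ> real_of_ereal) \<longlongrightarrow> pi) (at_left \<infinity>)"
      unfolding ereal_tendsto_simps1 .
  qed simp
  moreover have "einterval 0 \<infinity> = {0<..}" by (auto simp: einterval_def)
  ultimately show ?thesis by (simp add: set_integrable_def)
qed

text \<open>At n near v sqrt x the argument of c tends to 2 v. For c = ln the division by sqrt x
  removes the divergent (ln x) / 2.\<close>

definition riemann_term :: "(real \<Rightarrow> real) \<Rightarrow> real \<Rightarrow> nat \<Rightarrow> real" where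
  "riemann_term c x n = (scaled_bessel_diff x n)\<^sup>2 * c ((2 * real n + 1) / sqrt x)"

text \<open>Both the normalization (\<open>c = 1\<close>) and the logarithmic moment (\<open>c = ln\<close>) are instances.\<close>
context
  fixes c :: "real \<Rightarrow> real"
  assumes c_measurable [measurable]: "c \<in> borel_measurable borel"
    and c_cont: "\<And>w. 0 < w \<Longrightarrow> isCont c w"
    and c_bound: "\<And>w. 0 < w \<Longrightarrow> \<bar>c w\<bar> \<le> 2 * (1 + w) / sqrt w"
begin

lemma riemann_term_bound:
  assumes "0 < x" "0 < v"
  shows "\<bar>riemann_term c x (nat \<lfloor>v * sqrt x\<rfloor>)\<bar> \<le> 18432 * (1 / ((1 + v) * sqrt v))"
proof -
  define n where "n = nat \<lfloor>v * sqrt x\<rfloor>"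
  define w where "w = (2 * real n + 1) / sqrt x"
  define a where "a = \<bar>scaled_bessel_diff x n\<bar>"
  have "v * sqrt x < real n + 1"
    unfolding n_def using assms by linarith
  \<comment> \<open>This gives v <= w, so the final majorant, decreasing in w, can be passed to
    v.\<close>
  hence "v * sqrt x \<le> 2 * real n + 1" by simp
  hence vw: "v \<le> w" using assms by (simp add: w_def field_simps)
  hence w: "0 < w" using assms by simp
  have "a \<le> 64 / w"
    using scaled_bessel_diff_decay[OF assms(1), of n] by (simp add: a_def w_def)
  hence "a * w \<le> 64" using w by (simp add: field_simps)
  moreover have "a \<le> 32" unfolding a_def by (rule scaled_bessel_diff_bound[OF assms(1)])
  \<comment> \<open>The uniform bound 32 and the decay bound 64 add up to 96; 9216 is its square and
    18432 includes the 2 from \<open>c_bound\<close>.\<close>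
  ultimately have "a * (1 + w) \<le> 96" by (simp add: distrib_left)
  hence "(a * (1 + w))\<^sup>2 \<le> 96\<^sup>2" using w by (intro power_mono) (auto simp: a_def)
  hence a2: "a\<^sup>2 * (1 + w) \<le> 9216 / (1 + w)"
    using w by (simp add: power_mult_distrib pos_le_divide_eq power2_eq_square mult_ac)
  have "\<bar>riemann_term c x n\<bar> = a\<^sup>2 * \<bar>c w\<bar>"
    by (simp add: riemann_term_def w_def a_def abs_mult)
  also have "\<dots> \<le> a\<^sup>2 * (2 * (1 + w) / sqrt w)"
    by (intro mult_left_mono c_bound w) auto
  also have "\<dots> = a\<^sup>2 * (1 + w) * (2 / sqrt w)" by simp
  also have "\<dots> \<le> 9216 / (1 + w) * (2 / sqrt w)"
    using w by (intro mult_right_mono a2) auto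
  also have "\<dots> = 18432 * (1 / ((1 + w) * sqrt w))" by simp
  also have "\<dots> \<le> 18432 * (1 / ((1 + v) * sqrt v))"
    using vw assms by (intro mult_left_mono divide_left_mono mult_mono mult_pos_pos) auto
  finally show ?thesis by (simp add: n_def)
qed

lemma riemann_term_measurable: "(\<lambda>v. riemann_term c x (nat \<lfloor>v * sqrt x\<rfloor>)) \<in> borel_measurable borel"
proof -
  have "(\<lambda>v. nat \<lfloor>v * sqrt x\<rfloor>) \<in> measurable borel (count_space UNIV)" by measurable
  thus ?thesis by (rule measurable_compose) simp
qed

lemma AE_nonzero: "AE v in lborel. v \<noteq> (0::real)"
  by (rule AE_lborel_singleton)

lemma riemann_AE_bound:
  assumes "0 < x"
  shows "AE v in lborel. norm (indicator {0..} v *\<^sub>R riemann_term c x (nat \<lfloor>v * sqrt x\<rfloor>))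
    \<le> 18432 * (indicator {0<..} v * (1 / ((1 + v) * sqrt v)))"
  using AE_nonzero
proof eventually_elim
  case (elim v)
  show ?case
  proof (cases "0 < v")
    case True
    thus ?thesis using riemann_term_bound[OF assms True] by simp
  qed (use elim in auto)
qed

lemma riemann_integral_eq:
  assumes "0 < x"
  shows "(LINT v:{0..}|lborel. riemann_term c x (nat \<lfloor>v * sqrt x\<rfloor>)) = (\<Sum>n. riemann_term c x n / sqrt x)"
proof (rule integral_floor)
  show "set_integrable lborel {0..} (\<lambda>v. riemann_term c x (nat \<lfloor>v * sqrt x\<rfloor>))"
    unfolding set_integrable_def
  proof (rule Bochner_Integration.integrable_bound)
    show "integrable lborel (\<lambda>v::real. 18432 * (indicator {0<..} v * (1 / ((1 + v) * sqrt v))))"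
      by (intro integrable_mult_right integrable_dominator)
    show "(\<lambda>v. indicator {0..} v *\<^sub>R riemann_term c x (nat \<lfloor>v * sqrt x\<rfloor>)) \<in> borel_measurable lborel"
      using riemann_term_measurable[of x] by measurable
    show "AE v in lborel. norm (indicator {0..} v *\<^sub>R riemann_term c x (nat \<lfloor>v * sqrt x\<rfloor>))
        \<le> norm (18432 * (indicator {0<..} v * (1 / ((1 + v) * sqrt v))))"
      using riemann_AE_bound[OF assms]
      by eventually_elim (unfold real_norm_def, rule order_trans[OF _ abs_ge_self])
  qed
qed (use assms in simp)

lemma riemann_term_tendsto:
  assumes "0 < v"
  shows "((\<lambda>x. riemann_term c x (nat \<lfloor>v * sqrt x\<rfloor>)) \<longlongrightarrow> (v / (4 * sqrt pi) * exp (- (v\<^sup>2) / 4))\<^sup>2 * c (2 * v)) at_top"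
proof -
  let ?J = "\<lambda>x. nat \<lfloor>v * sqrt x\<rfloor>"
  have J: "((\<lambda>x. (real (?J x) + 1 / 2) / sqrt x) \<longlongrightarrow> v) at_top"
  proof (rule tendsto_sandwich)
    have b: "v * sqrt x - 1 \<le> real (?J x) \<and> real (?J x) \<le> v * sqrt x" if "0 < x" for x
    proof -
      have "0 \<le> v * sqrt x" using that assms by simp
      thus ?thesis by linarith
    qed
    show "\<forall>\<^sub>F x in at_top. (v * sqrt x - 1 / 2) / sqrt x \<le> (real (?J x) + 1 / 2) / sqrt x"
      using eventually_gt_at_top[of 0]
    proof eventually_elim
      case (elim x)
      thus ?case using b[OF elim] by (intro divide_right_mono) (linarith, simp)
    qed
    show "\<forall>\<^sub>F x in at_top. (real (?J x) + 1 / 2) / sqrt x \<le> (v * sqrt x + 1 / 2) / sqrt x"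
      using eventually_gt_at_top[of 0]
    proof eventually_elim
      case (elim x)
      thus ?case using b[OF elim] by (intro divide_right_mono) (linarith, simp)
    qed
    show "((\<lambda>x. (v * sqrt x - 1 / 2) / sqrt x) \<longlongrightarrow> v) at_top" by real_asymp
    show "((\<lambda>x. (v * sqrt x + 1 / 2) / sqrt x) \<longlongrightarrow> v) at_top" by real_asymp
  qed
  have "((\<lambda>x. 2 * ((real (?J x) + 1 / 2) / sqrt x)) \<longlongrightarrow> 2 * v) at_top"
    by (intro tendsto_intros J)
  moreover have "2 * ((real n + 1 / 2) / sqrt x) = (2 * real n + 1) / sqrt x" for n x
    by (simp add: distrib_left)
  ultimately have "((\<lambda>x. (2 * real (?J x) + 1) / sqrt x) \<longlongrightarrow> 2 * v) at_top" by simp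
  hence "((\<lambda>x. c ((2 * real (?J x) + 1) / sqrt x)) \<longlongrightarrow> c (2 * v)) at_top"
    by (rule isCont_tendsto_compose[rotated]) (use assms c_cont in auto)
  thus ?thesis
    unfolding riemann_term_def
    by (intro tendsto_mult tendsto_power scaled_bessel_diff_tendsto J)
qed

text \<open>The factor 1 / (16 pi) is the square of the constant 1 / (4 sqrt pi) in the local limit,
  and squaring the Gaussian produces the Maxwell density.\<close>

lemma riemann_limit:
  "((\<lambda>x. \<Sum>n. riemann_term c x n / sqrt x) \<longlongrightarrow>
     1 / (16 * pi) * (LINT v:{0<..}|lborel. v\<^sup>2 * exp (- (v\<^sup>2) / 2) * c (2 * v))) at_top"
proof -
  let ?g = "\<lambda>v. (v / (4 * sqrt pi) * exp (- (v\<^sup>2) / 4))\<^sup>2 * c (2 * v)"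
  have "((\<lambda>x. LINT v|lborel. indicator {0..} v *\<^sub>R riemann_term c x (nat \<lfloor>v * sqrt x\<rfloor>)) \<longlongrightarrow>
      (LINT v|lborel. indicator {0<..} v *\<^sub>R ?g v)) at_top"
  proof (rule integral_dominated_convergence_at_top)
    show "(\<lambda>v. indicator {0<..} v *\<^sub>R ?g v) \<in> borel_measurable lborel" by measurable
    show "(\<lambda>v. indicator {0..} v *\<^sub>R riemann_term c x (nat \<lfloor>v * sqrt x\<rfloor>)) \<in> borel_measurable lborel" for x
      using riemann_term_measurable[of x] by measurable
    show "integrable lborel (\<lambda>v::real. 18432 * (indicator {0<..} v * (1 / ((1 + v) * sqrt v))))"
      by (intro integrable_mult_right integrable_dominator)
    show "\<forall>\<^sub>F x in at_top. AE v in lborel. norm (indicator {0..} v *\<^sub>R riemann_term c x (nat \<lfloor>v * sqrt x\<rfloor>))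
        \<le> 18432 * (indicator {0<..} v * (1 / ((1 + v) * sqrt v)))"
      using eventually_gt_at_top[of 0] by eventually_elim (rule riemann_AE_bound)
    show "AE v in lborel. ((\<lambda>x. indicator {0..} v *\<^sub>R riemann_term c x (nat \<lfloor>v * sqrt x\<rfloor>)) \<longlongrightarrow> indicator {0<..} v *\<^sub>R ?g v) at_top"
      using AE_nonzero
    proof eventually_elim
      case (elim v)
      show ?case
      proof (cases "0 < v")
        case True
        thus ?thesis using riemann_term_tendsto[OF True] by simp
      qed (use elim in simp)
    qed
  qed
  also have "(\<lambda>v. indicator {0<..} v *\<^sub>R ?g v) =
      (\<lambda>v. 1 / (16 * pi) * (indicator {0<..} v *\<^sub>R (v\<^sup>2 * exp (- (v\<^sup>2) / 2) * c (2 * v))))"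
  proof
    fix v :: real
    have "(exp (- (v\<^sup>2) / 4))\<^sup>2 = exp (- (v\<^sup>2) / 2)"
      by (simp add: power2_eq_square exp_add[symmetric])
    thus "indicator {0<..} v *\<^sub>R ?g v = 1 / (16 * pi) * (indicator {0<..} v *\<^sub>R (v\<^sup>2 * exp (- (v\<^sup>2) / 2) * c (2 * v)))"
      by (simp add: power_mult_distrib power_divide)
  qed
  also have "(LINT v|lborel. 1 / (16 * pi) * (indicator {0<..} v *\<^sub>R (v\<^sup>2 * exp (- (v\<^sup>2) / 2) * c (2 * v)))) =
      1 / (16 * pi) * (LINT v:{0<..}|lborel. v\<^sup>2 * exp (- (v\<^sup>2) / 2) * c (2 * v))"
    unfolding set_lebesgue_integral_def by (rule integral_mult_right_zero)
  finally have "((\<lambda>x. LINT v|lborel. indicator {0..} v *\<^sub>R riemann_term c x (nat \<lfloor>v * sqrt x\<rfloor>)) \<longlongrightarrow>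
      1 / (16 * pi) * (LINT v:{0<..}|lborel. v\<^sup>2 * exp (- (v\<^sup>2) / 2) * c (2 * v))) at_top" .
  moreover have "\<forall>\<^sub>F x in at_top. (LINT v|lborel. indicator {0..} v *\<^sub>R riemann_term c x (nat \<lfloor>v * sqrt x\<rfloor>)) =
      (\<Sum>n. riemann_term c x n / sqrt x)"
    using eventually_gt_at_top[of 0]
    by eventually_elim (rule riemann_integral_eq[unfolded set_lebesgue_integral_def])
  ultimately show ?thesis by (rule Lim_transform_eventually)
qed

end

section \<open>The regime of large x\<close>

lemma sqrt_le_one_plus: "0 \<le> w \<Longrightarrow> sqrt w \<le> 1 + w" for w :: real
  by (rule real_le_lsqrt) (auto simp: power2_eq_square algebra_simps)

lemma one_bound: "0 < w \<Longrightarrow> \<bar>1\<bar> \<le> 2 * (1 + w) / sqrt w" for w :: real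
  using sqrt_le_one_plus[of w] by (simp add: field_simps)

text \<open>Apply ln u <= u - 1 to sqrt w and to 1 / sqrt w; the two resulting bounds add up to the
  admissible weight.\<close>

lemma ln_bound:
  fixes w :: real
  assumes "0 < w"
  shows "\<bar>ln w\<bar> \<le> 2 * (1 + w) / sqrt w"
proof -
  have "ln w \<le> 2 * sqrt w" "- ln w \<le> 2 / sqrt w"
    using assms ln_le_minus_one[of "sqrt w"] ln_le_minus_one[of "1 / sqrt w"]
    by (auto simp: ln_sqrt ln_div)
  moreover have "2 * (1 + w) / sqrt w = 2 / sqrt w + 2 * sqrt w"
  proof -
    have "2 * (1 + w) / sqrt w = 2 / sqrt w + 2 * (w / sqrt w)"
      by (simp add: add_divide_distrib distrib_left)
    also have "w / sqrt w = sqrt w" using assms by (simp add: real_div_sqrt)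
    finally show ?thesis .
  qed
  moreover have "0 \<le> sqrt w" "0 \<le> 2 / sqrt w" using assms by auto
  ultimately show ?thesis by linarith
qed

context haar_SU2
begin

text \<open>S2 / S1 is the mean of ln ((2 n + 1) / sqrt x) under the weights p_n, that is ln 2 *
  F(x) - (ln x) / 2.\<close>

lemma F_fun_large:
  "(\<lambda>x. F_fun M x - (1 / 2 * log 2 (2 * x) + (1 - euler_mascheroni / 2) / ln 2)) \<in> o[at_top](\<lambda>_. 1)"
proof -
  let ?I = "sqrt 2 * Gamma (3 / 2 :: real)"
  let ?L = "1 - euler_mascheroni / 2 + ln 2 / 2 :: real"
  define S1 where "S1 x = (\<Sum>n. riemann_term (\<lambda>_. 1) x n / sqrt x)" for x
  define S2 where "S2 x = (\<Sum>n. riemann_term ln x n / sqrt x)" for x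
  have S1: "(S1 \<longlongrightarrow> 1 / (16 * pi) * ?I) at_top"
  proof -
    have "(S1 \<longlongrightarrow> 1 / (16 * pi) * (LINT v:{0<..}|lborel. v\<^sup>2 * exp (- (v\<^sup>2) / 2) * 1)) at_top"
      unfolding S1_def by (rule riemann_limit[OF _ _ one_bound]) auto
    thus ?thesis by (simp only: mult_1_right maxwell_integral)
  qed
  have S2: "(S2 \<longlongrightarrow> 1 / (16 * pi) * (?I * ?L)) at_top"
    unfolding S2_def maxwell_log_integral[symmetric]
    by (rule riemann_limit[OF _ _ ln_bound]) (auto intro!: continuous_intros)
  have "Gamma (3 / 2 :: real) \<noteq> 0" using Gamma_real_pos[of "3 / 2"] by linarith
  hence I: "1 / (16 * pi) * ?I \<noteq> 0" by simp
  have "((\<lambda>x. S2 x / S1 x) \<longlongrightarrow> 1 / (16 * pi) * (?I * ?L) / (1 / (16 * pi) * ?I)) at_top"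
    by (rule tendsto_divide[OF S2 S1 I])
  also have "1 / (16 * pi) * (?I * ?L) / (1 / (16 * pi) * ?I) = ?L" using I by simp
  finally have "((\<lambda>x. (S2 x / S1 x - ?L) / ln 2) \<longlongrightarrow> (?L - ?L) / ln 2) at_top"
    by (intro tendsto_intros) simp_all
  hence lim: "((\<lambda>x. (S2 x / S1 x - ?L) / ln 2) \<longlongrightarrow> 0) at_top" by simp
  have eq: "(S2 x / S1 x - ?L) / ln 2 = F_fun M x - (1 / 2 * log 2 (2 * x) + (1 - euler_mascheroni / 2) / ln 2)"
    if x: "0 < x" for x
  proof -
    \<comment> \<open>The exponent 3 x combines the 2 x of the scaling with the exp x inside A_n; k
      cancels in the quotient.\<close>
    define k where "k = (x * exp (- (3 * x)))\<^sup>2 / sqrt x"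
    have k: "k > 0" using x by (simp add: k_def)
    have K: "(scaled_bessel_diff x n)\<^sup>2 / sqrt x = k * (A_coeff M n x)\<^sup>2" for n
    proof -
      have "exp (- (2 * x)) = exp (- (3 * x)) * exp x" by (simp add: exp_add[symmetric])
      hence "scaled_bessel_diff x n = x * exp (- (3 * x)) * A_coeff M n x"
        by (simp add: scaled_bessel_diff_def A_coeff_bessel)
      thus ?thesis by (simp add: k_def power_mult_distrib)
    qed
    have s1: "(\<lambda>n. k * (A_coeff M n x)\<^sup>2) sums (k * A_coeff M 0 (2 * x))"
      using x by (intro sums_mult sums_A_coeff_squared) simp
    have S1x: "S1 x = k * A_coeff M 0 (2 * x)"
      using sums_unique[OF s1] by (simp add: S1_def riemann_term_def K)
    have "(\<lambda>n. log 2 (2 * real n + 1) * (A_coeff M n x)\<^sup>2) sums log_sum x"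
      unfolding log_sum_def using x
      by (intro summable_sums weighted_summable log_weight_nonneg summable_log) simp
    hence "(\<lambda>n. k * ln 2 * (log 2 (2 * real n + 1) * (A_coeff M n x)\<^sup>2) - ln x / 2 * (k * (A_coeff M n x)\<^sup>2)) sums
        (k * ln 2 * log_sum x - ln x / 2 * (k * A_coeff M 0 (2 * x)))"
      by (intro sums_diff sums_mult s1)
    moreover have "k * ln 2 * (log 2 (2 * real n + 1) * (A_coeff M n x)\<^sup>2) - ln x / 2 * (k * (A_coeff M n x)\<^sup>2) =
        riemann_term ln x n / sqrt x" for n
    proof -
      have "ln ((2 * real n + 1) / sqrt x) = ln 2 * log 2 (2 * real n + 1) - ln x / 2"
        using x by (simp add: ln_div ln_sqrt log_def)
      hence "riemann_term ln x n / sqrt x = (scaled_bessel_diff x n)\<^sup>2 / sqrt x * (ln 2 * log 2 (2 * real n + 1) - ln x / 2)"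
        by (simp add: riemann_term_def)
      thus ?thesis unfolding K by (simp add: algebra_simps)
    qed
    ultimately have S2x: "S2 x = k * ln 2 * log_sum x - ln x / 2 * (k * A_coeff M 0 (2 * x))"
      unfolding S2_def by (simp add: sums_iff)
    have "A_coeff M 0 (2 * x) > 0" using A_coeff_0_ge_1[of "2 * x"] x by simp
    hence "S2 x / S1 x = ln 2 * (log_sum x / A_coeff M 0 (2 * x)) - ln x / 2"
      unfolding S1x S2x using k by (simp add: diff_divide_distrib)
    also have "log_sum x / A_coeff M 0 (2 * x) = F_fun M x" using x by (simp add: F_fun_eq)
    finally have "S2 x / S1 x = ln 2 * F_fun M x - ln x / 2" .
    \<comment> \<open>Half of this 1 absorbs the summand ln 2 / 2 of \<open>?L\<close>.\<close>
    moreover have "log 2 (2 * x) = 1 + ln x / ln 2"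
      using x by (simp add: log_def ln_mult add_divide_distrib)
    ultimately show ?thesis
      by (simp add: diff_divide_distrib add_divide_distrib)
  qed
  have "((\<lambda>x. F_fun M x - (1 / 2 * log 2 (2 * x) + (1 - euler_mascheroni / 2) / ln 2)) \<longlongrightarrow> 0) at_top"
  proof (rule Lim_transform_eventually[OF lim])
    show "\<forall>\<^sub>F x in at_top. (S2 x / S1 x - ?L) / ln 2 = F_fun M x - (1 / 2 * log 2 (2 * x) + (1 - euler_mascheroni / 2) / ln 2)"
      using eventually_gt_at_top[of 0] by eventually_elim (rule eq)
  qed
  thus ?thesis by (intro smalloI_tendsto) auto
qed

end

text \<open>The first two groups of conjuncts record nonzero denominators and convergent series, so
  that no quotient or infinite sum in the other claims is a default value.\<close>

theorem theoremG1:
  fixes M :: "(complex ^ 2 ^ 2) measure"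
  assumes haar: "normalized_haar_SU2 M"
  shows
    "(\<forall>L\<ge>1. \<forall>y\<ge>0. (\<Sum>j\<le>L. (a_coeff M L j y)\<^sup>2) \<noteq> 0) \<and>
     (\<forall>x\<ge>0. summable (\<lambda>k. (A_coeff M k x)\<^sup>2) \<and> (\<Sum>k. (A_coeff M k x)\<^sup>2) \<noteq> 0 \<and>
             bessel_I 0 (4 * x) - bessel_I 1 (4 * x) \<noteq> 0 \<and>
             summable (\<lambda>j. p_weight M j x * log 2 (2 * real j + 1))) \<and>
     (\<forall>x\<ge>0. \<forall>j. A_coeff M j x = exp x * (bessel_I j (2 * x) - bessel_I (j + 1) (2 * x))) \<and>
     (\<forall>x\<ge>0. \<forall>j. p_weight M j x =
        (bessel_I j (2 * x) - bessel_I (j + 1) (2 * x))\<^sup>2 / (bessel_I 0 (4 * x) - bessel_I 1 (4 * x))) \<and>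
     (\<forall>x\<ge>0. (\<lambda>L. Y_fun M L (x / real L)) \<longlonglongrightarrow> F_fun M x) \<and>
     (\<forall>x\<ge>0. \<exists>e>0. uniform_limit (ball x e \<inter> {0..})
        (\<lambda>L x'. Y_fun M L (x' / real L)) (F_fun M) sequentially) \<and>
     (\<lambda>x. F_fun M x - x\<^sup>2 * log 2 3) \<in> O[at_right 0](\<lambda>x. x ^ 3) \<and>
     (\<lambda>x. F_fun M x - (1 / 2 * log 2 (2 * x) + (1 - euler_mascheroni / 2) / ln 2)) \<in> o[at_top](\<lambda>_. 1)"
proof -
  interpret haar_SU2 M by (rule haar_SU2.intro) (rule haar)
  \<comment> \<open>Here A_0 is taken at 2 x, which doubles the Bessel argument to 4 x; its factor
    exp (2 x) later cancels the square of exp x in p_j.\<close>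
  have D: "bessel_I 0 (4 * x) - bessel_I 1 (4 * x) = A_coeff M 0 (2 * x) / exp (2 * x)" for x
    by (simp add: A_coeff_bessel bessel_diff_def)
  have A: "A_coeff M j x = exp x * (bessel_I j (2 * x) - bessel_I (j + 1) (2 * x))" for j x
    by (simp add: A_coeff_bessel bessel_diff_def)
  have unif: "uniform_limit (ball x 1 \<inter> {0..}) (\<lambda>L x'. Y_fun M L (x' / real L)) (F_fun M) sequentially"
    if "0 \<le> x" for x
    by (rule uniform_limit_on_subset[OF uniform_limit_Y[of "x + 1"]]) (use that in \<open>auto simp: dist_real_def\<close>)
  show ?thesis
  proof (intro conjI allI impI)
    show "(\<Sum>j\<le>L. (a_coeff M L j y)\<^sup>2) \<noteq> 0" if "0 \<le> y" for L y
      using a_coeff_0_ge_1[OF that, of "2 * L"] by (simp add: sum_a_coeff_squared)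
    fix x :: real assume x: "0 \<le> x"
    have A0: "A_coeff M 0 (2 * x) \<noteq> 0" using A_coeff_0_ge_1[of "2 * x"] x by simp
    show "summable (\<lambda>k. (A_coeff M k x)\<^sup>2)" "(\<Sum>k. (A_coeff M k x)\<^sup>2) \<noteq> 0"
      using sums_A_coeff_squared[OF x] A0 by (simp_all add: sums_iff)
    show "bessel_I 0 (4 * x) - bessel_I 1 (4 * x) \<noteq> 0"
      unfolding D using A0 by simp
    show "summable (\<lambda>j. p_weight M j x * log 2 (2 * real j + 1))"
      using F_sums[OF x] by (rule sums_summable)
    show "A_coeff M j x = exp x * (bessel_I j (2 * x) - bessel_I (j + 1) (2 * x))" for j
      by (rule A)
    show "p_weight M j x = (bessel_I j (2 * x) - bessel_I (j + 1) (2 * x))\<^sup>2 / (bessel_I 0 (4 * x) - bessel_I 1 (4 * x))" for j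
    proof -
      have "exp (2 * x) = (exp x)\<^sup>2" by (simp add: power2_eq_square exp_add[symmetric])
      thus ?thesis
        unfolding D p_weight_eq[OF x] A[of j] by (simp add: power_mult_distrib)
    qed
    show "(\<lambda>L. Y_fun M L (x / real L)) \<longlonglongrightarrow> F_fun M x"
      by (rule tendsto_uniform_limitI[OF unif[OF x]]) (use x in simp)
    show "\<exists>e>0. uniform_limit (ball x e \<inter> {0..}) (\<lambda>L x'. Y_fun M L (x' / real L)) (F_fun M) sequentially"
      using unif[OF x] zero_less_one by blast
  next
    show "(\<lambda>x. F_fun M x - x\<^sup>2 * log 2 3) \<in> O[at_right 0](\<lambda>x. x ^ 3)"
      by (rule F_fun_small)
    show "(\<lambda>x. F_fun M x - (1 / 2 * log 2 (2 * x) + (1 - euler_mascheroni / 2) / ln 2)) \<in> o[at_top](\<lambda>_. 1)"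
      by (rule F_fun_large)
  qed
qed

end
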